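(* Let $P\in\mathcal{T}$, i.e. let $P$ be a convex polytope with all nine vertices on $\mathbb{S}^2$ which is combinatorially equivalent to the triaugmented triangular prism. Then $\operatorname{vol}(P)\le 3\sqrt{2\sqrt3-3}$, with equality if and only if $P$ is a rotation of the triaugmented triangular prism with vertices $$a_1=(1,0,0),\quad a_2=\left(-\tfrac12,\tfrac{\sqrt3}{2},0\right),\quad a_3=\left(-\tfrac12,-\tfrac{\sqrt3}{2},0\right),$$ $$x_1=\left(\tfrac12 r_*,\tfrac{\sqrt3}{2}r_*,h_*\right),\quad x_2=(-r_*,0,h_* ),\quad x_3=\left(\tfrac12 r_*,-\tfrac{\sqrt3}{2}r_*,h_*\right),$$ $$y_1=\left(\tfrac12 r_*,\tfrac{\sqrt3}{2}r_*,-h_*\right),\quad y_2=(-r_*,0,-h_* ),\quad y_3=\left(\tfrac12 r_*,-\tfrac{\sqrt3}{2}r_*,-h_*\right),$$ where $h_*:=\sqrt{2\sqrt3-3}$ and $r_*:=\sqrt{1-h_*^2}=\sqrt{4-2\sqrt3}=\sqrt3-1$.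
   Context: $\mathbb{S}^2$ is the unit sphere in $\mathbb{R}^3$ and $\operatorname{vol}$ is 3-dimensional volume. Two polytopes are combinatorially equivalent if there is an inclusion-preserving bijection between their sets of faces. $\mathcal{P}_9$ is the set of convex polytopes in $\mathbb{R}^3$ with at most nine vertices, all on $\mathbb{S}^2$. $\mathcal{T}$ is the set of all polytopes in $\mathcal{P}_9$ combinatorially equivalent to the triaugmented triangular prism, i.e. the simplicial polytope with nine vertices $x_1,x_2,x_3,y_1,y_2,y_3,a_1,a_2,a_3$ and the 14 triangular facets $[x_1,x_2,x_3]$, $[y_1,y_2,y_3]$ and, for $i=1,2,3$ (indices modulo 3), $[a_i,x_i,y_i]$, $[a_i,y_i,y_{i+1}]$, $[a_i,y_{i+1},x_{i+1}]$, $[a_i,x_{i+1},x_i]$. *)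

theory Defs
  imports "HOL-Analysis.Analysis"
begin

definition vertices :: "'a::euclidean_space set \<Rightarrow> 'a set" where
  "vertices P = {v. v extreme_point_of P}"

text \<open>Faces are in the sense of \<open>face_of\<close>, so the improper faces
  (the empty set and the polytope itself) are included on both sides.\<close>

definition combinatorially_equivalent ::
  "'a::euclidean_space set \<Rightarrow> 'b::euclidean_space set \<Rightarrow> bool" where
  "combinatorially_equivalent P Q \<longleftrightarrow>
     (\<exists>f. bij_betw f {F. F face_of P} {G. G face_of Q} \<and>
          (\<forall>F F'. F face_of P \<longrightarrow> F' face_of P \<longrightarrow> (F \<subseteq> F' \<longleftrightarrow> f F \<subseteq> f F')))"

definition simplicial_3polytope :: "(real^3) set \<Rightarrow> bool" where
  "simplicial_3polytope Q \<longleftrightarrow>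
     polytope Q \<and> aff_dim Q = 3 \<and> (\<forall>F. F facet_of Q \<longrightarrow> 2 simplex F)"

text \<open>Indices live in the numeral type \<open>3\<close> of integers modulo 3, so that \<open>i + 1\<close> is cyclic
  and the index 3 is the element 0.\<close>

definition triaugmented_triangular_prism :: "(real^3) set \<Rightarrow> bool" where
  "triaugmented_triangular_prism Q \<longleftrightarrow>
     simplicial_3polytope Q \<and>
     (\<exists>x y a :: 3 \<Rightarrow> real^3.
        vertices Q = range x \<union> range y \<union> range a \<and> card (vertices Q) = 9 \<and>
        {F. F facet_of Q} =
          {convex hull {x 1, x 2, x 3}, convex hull {y 1, y 2, y 3}} \<union>
          (\<Union>i. {convex hull {a i, x i, y i},
                 convex hull {a i, y i, y (i + 1)},
                 convex hull {a i, y (i + 1), x (i + 1)},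
                 convex hull {a i, x (i + 1), x i}}))"

definition P9 :: "(real^3) set set" where
  "P9 = {P. polytope P \<and> card (vertices P) \<le> 9 \<and> vertices P \<subseteq> sphere 0 1}"

definition TTP_class :: "(real^3) set set" where
  "TTP_class = {P \<in> P9. \<exists>Q. triaugmented_triangular_prism Q \<and> combinatorially_equivalent P Q}"

definition h_star :: real where
  "h_star = sqrt (2 * sqrt 3 - 3)"

definition r_star :: real where
  "r_star = sqrt (1 - h_star\<^sup>2)"

lemma r_star_eq:
  "r_star = sqrt (4 - 2 * sqrt 3)"
  "r_star = sqrt 3 - 1"
proof -
  have "3 / 2 \<le> sqrt 3"
    by (rule real_le_rsqrt) (simp add: power2_eq_square)
  then have "h_star\<^sup>2 = 2 * sqrt 3 - 3"
    unfolding h_star_def by simp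
  then show *: "r_star = sqrt (4 - 2 * sqrt 3)"
    unfolding r_star_def by simp
  have "4 - 2 * sqrt 3 = (sqrt 3 - 1)\<^sup>2"
    by (simp add: power2_diff)
  then show "r_star = sqrt 3 - 1"
    using * by simp
qed

text \<open>Listed in the order \<open>a\<close>, \<open>x\<close>, \<open>y\<close>. The numbering of the coordinates differs from the
  one in \<open>triaugmented_triangular_prism\<close> by a cyclic shift of the \<open>a\<close>'s: here the first
  \<open>a\<close>-vertex is adjacent to the first and third \<open>x\<close>- and \<open>y\<close>-vertices.\<close>

definition optimal_prism :: "(real^3) set" where
  "optimal_prism = convex hull
     {vector [1, 0, 0],
      vector [- 1/2, sqrt 3 / 2, 0],
      vector [- 1/2, - sqrt 3 / 2, 0],
      vector [1/2 * r_star, sqrt 3 / 2 * r_star, h_star],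
      vector [- r_star, 0, h_star],
      vector [1/2 * r_star, - sqrt 3 / 2 * r_star, h_star],
      vector [1/2 * r_star, sqrt 3 / 2 * r_star, - h_star],
      vector [- r_star, 0, - h_star],
      vector [1/2 * r_star, - sqrt 3 / 2 * r_star, - h_star]}"

end

theory Submission
  imports Defs
begin

text \<open>
  Splitting \<open>P\<close> into cones over its facets from an interior point, and using that adjacent facets
  are oriented coherently, gives
  \<open>6 vol P = det (x\<^sub>1, x\<^sub>2, x\<^sub>3) - det (y\<^sub>1, y\<^sub>2, y\<^sub>3) + \<Sum>\<^sub>i a\<^sub>i \<bullet> ((x\<^sub>i - y\<^sub>i\<^sub>+\<^sub>1) \<times> (y\<^sub>i - x\<^sub>i\<^sub>+\<^sub>1))\<close>
  up to orientation. Write \<open>x\<^sub>i = u\<^sub>i + v\<^sub>i\<close> and \<open>y\<^sub>i = u\<^sub>i - v\<^sub>i\<close>; the cross product becomes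
  \<open>2 (u\<^sub>i\<^sub>+\<^sub>1 - u\<^sub>i) \<times> (v\<^sub>i + v\<^sub>i\<^sub>+\<^sub>1)\<close>. Let \<open>q\<close>, \<open>k\<close> be the norms of the means of the \<open>u\<^sub>i\<close> and the \<open>v\<^sub>i\<close>,
  and \<open>T\<^sup>2\<close>, \<open>W\<^sup>2\<close> their variances. Since all points lie on the sphere,
  \<open>k\<^sup>2 + T\<^sup>2 + W\<^sup>2 + q\<^sup>2 = 1\<close>, and estimating the areas of triangles and applying the Cauchy-Schwarz inequality bounds
  \<open>vol P\<close> by \<open>sqrt 3 / 2\<close> times \<open>k (T\<^sup>2 + W\<^sup>2) + 2 q T W + 2 T sqrt (4 k\<^sup>2 + W\<^sup>2)\<close>.
  Under the constraint this is maximal only for \<open>q = W = 0\<close>, \<open>k = h_star\<close>, \<open>T = r_star\<close>, which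
  forces the optimal prism.
\<close>

unbundle cross3_syntax

section \<open>The scalar inequality\<close>

lemma h_star_sq: "h_star\<^sup>2 = 2 * sqrt 3 - 3" and h_star_pos: "h_star > 0"
proof -
  have "(3 / 2)\<^sup>2 < (sqrt 3)\<^sup>2" by (simp add: power2_eq_square)
  then have "3 / 2 < sqrt 3"
    by (rule power2_less_imp_less) simp
  then show "h_star\<^sup>2 = 2 * sqrt 3 - 3" "h_star > 0"
    unfolding h_star_def by simp_all
qed

lemma sqrt_3_bounds: "1732 / 1000 < sqrt 3" "sqrt 3 < 1733 / 1000"
  by (rule real_less_rsqrt, simp add: power2_eq_square) (rule real_less_lsqrt, simp_all add: power2_eq_square)

lemma h_star_bounds: "6811 / 10000 < h_star" "h_star < 6827 / 10000"
proof -
  have "(6811 / 10000)\<^sup>2 < h_star\<^sup>2" "h_star\<^sup>2 < (6827 / 10000)\<^sup>2"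
    unfolding h_star_sq using sqrt_3_bounds by (simp_all add: power2_eq_square)
  then show "6811 / 10000 < h_star" "h_star < 6827 / 10000"
    using h_star_pos by (auto simp del: power_divide dest: power2_less_imp_less)
qed

lemma r_star_pos: "r_star > 0" and r_star_sq: "r_star\<^sup>2 = 1 - h_star\<^sup>2"
  using sqrt_3_bounds h_star_sq
  by (simp_all add: r_star_eq(2) power2_eq_square algebra_simps)

text \<open>The last two terms bound \<open>2 * T * sqrt (4 * k\<^sup>2 + W\<^sup>2)\<close> by the weighted inequality between the
  arithmetic and the geometric mean; the weight \<open>h_star * (sqrt 3 + 1) = 2 * h_star / r_star\<close>,
  with inverse \<open>h_star * (sqrt 3 + 3) / 6\<close>, is the one with equality at the optimum
  \<open>k = h_star\<close>, \<open>T = r_star\<close>, \<open>W = q = 0\<close>.\<close>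

definition scalar_functional :: "real \<Rightarrow> real \<Rightarrow> real \<Rightarrow> real \<Rightarrow> real" where
  "scalar_functional k T W q = k * (T\<^sup>2 + W\<^sup>2) + 2 * q * T * W
     + h_star * (sqrt 3 + 1) * T\<^sup>2 + h_star * (sqrt 3 + 3) / 6 * (4 * k\<^sup>2 + W\<^sup>2)"

text \<open>Once the mixed term is estimated, eliminating \<open>T\<^sup>2\<close> by the constraint
  leaves a cubic in \<open>k\<close> and multiples of \<open>W\<^sup>2\<close> and
  \<open>q\<^sup>2\<close> with negative coefficients. The nonnegative terms added on the left later
  decide the equality case.\<close>

lemma scalar_functional_bound:
  assumes "k \<ge> 0" and norm: "k\<^sup>2 + T\<^sup>2 + W\<^sup>2 + q\<^sup>2 = 1"
  shows "scalar_functional k T W q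
    + ((k - h_star)\<^sup>2 * k + (k - h_star)\<^sup>2 * h_star + W\<^sup>2 / 2 + q\<^sup>2 / 5) \<le> 2 * sqrt 3 * h_star"
proof -
  define h s where "h = h_star" and "s = sqrt 3"
  have s2: "s\<^sup>2 = 3" and h2: "h\<^sup>2 = 2 * s - 3" and b: "1732/1000 < s" "s < 1733/1000" "6811/10000 < h" "h < 6827/10000"
    using h_star_sq sqrt_3_bounds h_star_bounds by (simp_all add: h_def s_def)
  have T2: "T\<^sup>2 = 1 - k\<^sup>2 - W\<^sup>2 - q\<^sup>2" using norm by simp
  have "6811/10000 * (1732/1000) < h * s"
    using b by (intro mult_strict_mono) auto
  then have hs: "1179/1000 < h * s" by simp
  \<comment> \<open>The cubic takes the value \<open>2 * s * h\<close> at \<open>k = h\<close>, to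
    second order; the two identities below, which follow from \<open>h2\<close> and
    \<open>s2\<close>, make the leftover linear and constant terms vanish.\<close>
  have cubic: "(k + h * (s + 1)) * (1 - k\<^sup>2) + h * (s + 3) / 6 * 4 * k\<^sup>2
      + (k - h)\<^sup>2 * (k + h * (1 + s / 3)) = 2 * s * h" 
  proof -
    have "h\<^sup>2 * (1 + 2 * s / 3) = 1" "h\<^sup>2 * (1 + s / 3) = s - 1"
      unfolding h2 using s2 by (simp_all add: power2_eq_square field_simps)
    moreover have "(k + h * (s + 1)) * (1 - k\<^sup>2) + h * (s + 3) / 6 * 4 * k\<^sup>2
      + (k - h)\<^sup>2 * (k + h * (1 + s / 3))
      = 2 * s * h + k * (1 - h\<^sup>2 * (1 + 2 * s / 3)) + h * (h\<^sup>2 * (1 + s / 3) - (s - 1))"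
      by (simp add: power2_eq_square field_simps)
    ultimately show ?thesis by simp
  qed
  \<comment> \<open>The weights 3/2 and 2/3, together with \<open>T\<^sup>2 \<le> 1\<close>, leave
    room: the final coefficients of \<open>q\<^sup>2\<close> and \<open>W\<^sup>2\<close> stay below
    -1/5 and -1/2.\<close>
  have "2 * q * T * W \<le> 3/2 * q\<^sup>2 + 2/3 * (T\<^sup>2 * W\<^sup>2)"
  proof -
    have "0 \<le> (3 * q - 2 * (T * W))\<^sup>2" by simp
    then show ?thesis by (simp add: power2_eq_square algebra_simps)
  qed
  then have 1: "scalar_functional k T W q \<le> k * (T\<^sup>2 + W\<^sup>2) + 3/2 * q\<^sup>2 + 2/3 * (T\<^sup>2 * W\<^sup>2)
      + h * (s + 1) * T\<^sup>2 + h * (s + 3) / 6 * (4 * k\<^sup>2 + W\<^sup>2)"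
    unfolding scalar_functional_def h_def s_def by simp
  have "T\<^sup>2 * W\<^sup>2 \<le> 1 * W\<^sup>2"
    using T2 zero_le_power2[of k] zero_le_power2[of W] zero_le_power2[of q]
    by (intro mult_right_mono) (linarith, simp)
  then have 2: "scalar_functional k T W q \<le> k * (T\<^sup>2 + W\<^sup>2) + 3/2 * q\<^sup>2 + 2/3 * W\<^sup>2
      + h * (s + 1) * T\<^sup>2 + h * (s + 3) / 6 * (4 * k\<^sup>2 + W\<^sup>2)"
    using 1 by linarith
  also have "\<dots> = (k + h * (s + 1)) * (1 - k\<^sup>2) + h * (s + 3) / 6 * 4 * k\<^sup>2
      + W\<^sup>2 * (2/3 + h * (s + 3) / 6 - h * (s + 1)) + q\<^sup>2 * (3/2 - k - h * (s + 1))"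
    unfolding T2 by (simp add: field_simps)
  also have "\<dots> \<le> (k + h * (s + 1)) * (1 - k\<^sup>2) + h * (s + 3) / 6 * 4 * k\<^sup>2
      + W\<^sup>2 * (- 1/2) + q\<^sup>2 * (- 1/5)"
  proof -
    have eq: "h * (s + 3) / 6 = (h * s) / 6 + h / 2" "h * (s + 1) = h * s + h"
      by (simp_all add: field_simps)
    have "2/3 + h * (s + 3) / 6 - h * (s + 1) \<le> - 1/2"
      unfolding eq using b(3) hs by argo
    moreover have "3/2 - k - h * (s + 1) \<le> - 1/5"
      unfolding eq using b(3) hs \<open>k \<ge> 0\<close> by argo
    ultimately show ?thesis
      by (intro add_mono mult_left_mono order_refl) auto
  qed
  finally have 3: "scalar_functional k T W q + W\<^sup>2 / 2 + q\<^sup>2 / 5 + (k - h)\<^sup>2 * (k + h * (1 + s / 3))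
     \<le> 2 * s * h" unfolding cubic[symmetric] by simp
  have "(k - h)\<^sup>2 * (k + h) \<le> (k - h)\<^sup>2 * (k + h * (1 + s / 3))"
    using b by (intro mult_left_mono) (auto simp: algebra_simps)
  then show ?thesis using 3 unfolding h_def s_def by (simp add: algebra_simps)
qed

section \<open>The inequality for six points in space\<close>

lemma norm_cross_le: "norm (a \<times> b) \<le> norm a * norm (b :: real^3)"
proof -
  have "(norm (a \<times> b))\<^sup>2 \<le> (norm a * norm b)\<^sup>2"
    using norm_cross_dot[of a b] zero_le_power2[of "a \<bullet> b"] by linarith
  then show ?thesis by (rule power2_le_imp_le) simp
qed

lemma triple_le: "a \<bullet> (b \<times> c) \<le> norm a * (norm b * norm (c :: real^3))"
  by (meson Cauchy_Schwarz_ineq2 abs_le_D1 mult_left_mono norm_cross_le norm_ge_zero order_trans)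

text \<open>For \<open>x\<^sub>i = u\<^sub>i + v\<^sub>i\<close> and \<open>y\<^sub>i = u\<^sub>i - v\<^sub>i\<close> this is three times the volume of the
  polytope, maximised over the apices \<open>a\<^sub>i\<close>.\<close>

definition midpoint_functional :: "real^3 \<Rightarrow> real^3 \<Rightarrow> real^3 \<Rightarrow> real^3 \<Rightarrow> real^3 \<Rightarrow> real^3 \<Rightarrow> real" where
  "midpoint_functional u1 u2 u3 v1 v2 v3 =
     u1 \<bullet> (u2 \<times> v3) + u2 \<bullet> (u3 \<times> v1) + u3 \<bullet> (u1 \<times> v2) + v1 \<bullet> (v2 \<times> v3)
     + norm ((u2 - u1) \<times> (v1 + v2)) + norm ((u3 - u2) \<times> (v2 + v3)) + norm ((u1 - u3) \<times> (v3 + v1))"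

text \<open>\<open>a \<times> b\<close> is four times the area vector of the triangle of the
  \<open>u\<close>'s, and \<open>a' \<times> b'\<close> that of the \<open>v\<close>'s. The
  expansion separates sums from differences, so that each summand can be bounded by norms.\<close>

lemma triple_products_mean_decomposition:
  fixes u1 u2 u3 v1 v2 v3 :: "real^3"
  defines "a \<equiv> u1 - u2" and "b \<equiv> u1 + u2 - 2 *\<^sub>R u3" and "a' \<equiv> v1 - v2" and "b' \<equiv> v1 + v2 - 2 *\<^sub>R v3"
  shows "6 * (u1 \<bullet> (u2 \<times> v3) + u2 \<bullet> (u3 \<times> v1) + u3 \<bullet> (u1 \<times> v2) + v1 \<bullet> (v2 \<times> v3))
    = (v1 + v2 + v3) \<bullet> (a \<times> b) + (v1 + v2 + v3) \<bullet> (a' \<times> b')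
     + (u1 + u2 + u3) \<bullet> (a \<times> b') + (u1 + u2 + u3) \<bullet> (a' \<times> b)"
  unfolding assms by (simp add: cross3_simps)

lemma amgm_weighted: "c > 0 \<Longrightarrow> 2 * (x * y) \<le> c * x\<^sup>2 + y\<^sup>2 / (c::real)"
proof -
  assume "c > 0"
  then have "0 \<le> (c * x - y)\<^sup>2 / c" by simp
  also have "\<dots> = c * x\<^sup>2 + y\<^sup>2 / c - 2 * (x * y)"
    using \<open>c > 0\<close> by (simp add: power2_eq_square field_simps)
  finally show ?thesis by simp
qed

text \<open>\<open>k\<close> and \<open>q\<close> are the norms of the means,
  \<open>T\<^sup>2\<close> and \<open>W\<^sup>2\<close> the variances of the two triples. Triple
  products are estimated through the mean decomposition; for the cross products a weight fixed in
  advance gives bounds linear in squared lengths, whose sums over the three pairs depend on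
  \<open>T\<close>, \<open>k\<close> and \<open>W\<close> alone.\<close>

lemma midpoint_functional_le_scalar:
  fixes u1 u2 u3 v1 v2 v3 :: "real^3"
  defines "k \<equiv> norm (v1 + v2 + v3) / 3" and "q \<equiv> norm (u1 + u2 + u3) / 3"
    and "T \<equiv> sqrt (((norm (u1 - u2))\<^sup>2 + (norm (u1 + u2 - 2 *\<^sub>R u3))\<^sup>2 / 3) / 6)"
    and "W \<equiv> sqrt (((norm (v1 - v2))\<^sup>2 + (norm (v1 + v2 - 2 *\<^sub>R v3))\<^sup>2 / 3) / 6)"
  shows "midpoint_functional u1 u2 u3 v1 v2 v3 \<le> 3 * sqrt 3 / 2 * scalar_functional k T W q"
proof -
  define a b a' b' where ab: "a = u1 - u2" "b = u1 + u2 - 2 *\<^sub>R u3" "a' = v1 - v2" "b' = v1 + v2 - 2 *\<^sub>R v3"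
  define s where "s = sqrt 3"
  have s: "s > 0" "s * s = 3" by (auto simp: s_def)
  have h: "h_star > 0" by (rule h_star_pos)
  have T2: "6 * T\<^sup>2 = (norm a)\<^sup>2 + (norm b)\<^sup>2 / 3" and W2: "6 * W\<^sup>2 = (norm a')\<^sup>2 + (norm b')\<^sup>2 / 3"
    and T0: "T \<ge> 0" and W0: "W \<ge> 0" and q0: "q \<ge> 0" and k0: "k \<ge> 0"
    unfolding T_def W_def ab k_def q_def by simp_all
  \<comment> \<open>The weight makes this sharp for \<open>norm y = s * norm x\<close>, the ratio
    between twice the height and the side of an equilateral triangle.\<close>
  have area: "norm x * norm y \<le> s / 2 * ((norm x)\<^sup>2 + (norm y)\<^sup>2 / 3)" for x y :: "real^3"
  proof -
    have "2 * (norm x * norm y) \<le> s * (norm x)\<^sup>2 + (norm y)\<^sup>2 / s"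
      by (rule amgm_weighted) (use s in auto)
    also have "(norm y)\<^sup>2 / s = s * ((norm y)\<^sup>2 / 3)"
      using s by (simp add: field_simps)
    finally show ?thesis by (simp add: algebra_simps)
  qed
  have "(v1 + v2 + v3) \<bullet> (a \<times> b) \<le> 3 * k * (norm a * norm b)"
    using triple_le[of "v1 + v2 + v3" a b] by (simp add: k_def)
  also have "\<dots> \<le> 3 * k * (s / 2 * (6 * T\<^sup>2))"
    unfolding T2 using area k0 by (intro mult_left_mono) auto
  finally have 1: "(v1 + v2 + v3) \<bullet> (a \<times> b) \<le> 9 * s * k * T\<^sup>2" by (simp add: mult_ac)
  have "(v1 + v2 + v3) \<bullet> (a' \<times> b') \<le> 3 * k * (norm a' * norm b')"
    using triple_le[of "v1 + v2 + v3" a' b'] by (simp add: k_def)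
  also have "\<dots> \<le> 3 * k * (s / 2 * (6 * W\<^sup>2))"
    unfolding W2 using area k0 by (intro mult_left_mono) auto
  finally have 2: "(v1 + v2 + v3) \<bullet> (a' \<times> b') \<le> 9 * s * k * W\<^sup>2" by (simp add: mult_ac)
  \<comment> \<open>Cauchy-Schwarz for the plane vectors \<open>(norm a, norm b / s)\<close> and
    \<open>(norm b' / s, norm a')\<close>, in the form of Lagrange's identity.\<close>
  have "norm a * norm b' + norm a' * norm b \<le> 6 * s * (T * W)"
  proof (rule power2_le_imp_le)
    have "(norm a * norm b' + norm a' * norm b)\<^sup>2
        = 3 * (((norm a)\<^sup>2 + (norm b)\<^sup>2 / 3) * ((norm a')\<^sup>2 + (norm b')\<^sup>2 / 3))
           - 3 * (norm a * norm a' - norm b * norm b' / 3)\<^sup>2"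
      by (simp add: power2_eq_square field_simps)
    also have "\<dots> \<le> 3 * ((6 * T\<^sup>2) * (6 * W\<^sup>2))" unfolding T2 W2 by simp
    also have "\<dots> = (s * s) * (36 * (T * W)\<^sup>2)" unfolding s by (simp add: power2_eq_square)
    also have "\<dots> = (6 * s * (T * W))\<^sup>2" by (simp add: power2_eq_square)
    finally show "(norm a * norm b' + norm a' * norm b)\<^sup>2 \<le> (6 * s * (T * W))\<^sup>2" .
  qed (use s T0 W0 in auto)
  then have "3 * q * (norm a * norm b' + norm a' * norm b) \<le> 3 * q * (6 * s * (T * W))"
    using q0 by (intro mult_left_mono) auto
  moreover have "(u1 + u2 + u3) \<bullet> (a \<times> b') + (u1 + u2 + u3) \<bullet> (a' \<times> b) \<le> 3 * q * (norm a * norm b' + norm a' * norm b)"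
    using triple_le[of "u1 + u2 + u3" a b'] triple_le[of "u1 + u2 + u3" a' b]
    by (simp add: q_def distrib_left)
  ultimately have 3: "(u1 + u2 + u3) \<bullet> (a \<times> b') + (u1 + u2 + u3) \<bullet> (a' \<times> b) \<le> 18 * s * (q * T * W)"
    by (simp add: mult_ac)
  \<comment> \<open>At the optimum the differences \<open>u2 - u1\<close> have length
    \<open>s * r_star\<close> and the sums \<open>v1 + v2\<close> length \<open>2 * h_star\<close>.
    Their ratio is \<open>c\<close>, because \<open>r_star * (s + 1) = 2\<close>.\<close>
  define c where "c = h_star * (s + 1) / s"
  have c: "c > 0" using h s by (simp add: c_def)
  have pair: "norm (x \<times> y) \<le> (c * (norm x)\<^sup>2 + (norm y)\<^sup>2 / c) / 2" for x y :: "real^3"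
  proof -
    have "2 * norm (x \<times> y) \<le> 2 * (norm x * norm y)"
      using norm_cross_le[of x y] by simp
    also have "\<dots> \<le> c * (norm x)\<^sup>2 + (norm y)\<^sup>2 / c"
      by (rule amgm_weighted[OF c])
    finally show ?thesis by simp
  qed
  \<comment> \<open>The squared sides of a triangle add up to nine times the variance of its
    vertices. In \<open>S\<close> below, each \<open>v1 + v2\<close> is the total minus the third
    vector, so the mean enters as well.\<close>
  have D: "(norm (u2 - u1))\<^sup>2 + (norm (u3 - u2))\<^sup>2 + (norm (u1 - u3))\<^sup>2 = 9 * T\<^sup>2"
  proof -
    have "18 * T\<^sup>2 = 3 * (norm a)\<^sup>2 + (norm b)\<^sup>2" using T2 by simp
    also have "\<dots> = 2 * ((norm (u2 - u1))\<^sup>2 + (norm (u3 - u2))\<^sup>2 + (norm (u1 - u3))\<^sup>2)"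
      unfolding ab power2_norm_eq_inner by (simp add: inner_commute algebra_simps)
    finally show ?thesis by simp
  qed
  have S: "(norm (v1 + v2))\<^sup>2 + (norm (v2 + v3))\<^sup>2 + (norm (v3 + v1))\<^sup>2 = 12 * k\<^sup>2 + 3 * W\<^sup>2"
  proof -
    have "72 * k\<^sup>2 = 8 * (norm (v1 + v2 + v3))\<^sup>2" by (simp add: k_def power_divide)
    moreover have "18 * W\<^sup>2 = 3 * (norm a')\<^sup>2 + (norm b')\<^sup>2" using W2 by simp
    moreover have "8 * (norm (v1 + v2 + v3))\<^sup>2 + (3 * (norm a')\<^sup>2 + (norm b')\<^sup>2)
        = 6 * ((norm (v1 + v2))\<^sup>2 + (norm (v2 + v3))\<^sup>2 + (norm (v3 + v1))\<^sup>2)"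
      unfolding ab power2_norm_eq_inner by (simp add: inner_commute algebra_simps)
    ultimately have "6 * ((norm (v1 + v2))\<^sup>2 + (norm (v2 + v3))\<^sup>2 + (norm (v3 + v1))\<^sup>2)
        = 6 * (12 * k\<^sup>2 + 3 * W\<^sup>2)" by argo
    then show ?thesis by simp
  qed
  have inv_c: "1 / c = s * (h_star * (s + 3) / 6)"
  proof -
    have "(s + 1) * (s + 3) = 6 + 4 * s" "(2 * s - 3) * (6 + 4 * s) = 6"
      using s by (simp_all add: algebra_simps)
    then have "h_star\<^sup>2 * (s + 1) * (s + 3) = 6"
      unfolding h_star_sq s_def[symmetric] mult.assoc by simp
    moreover have "c * (s * (h_star * (s + 3) / 6)) = h_star\<^sup>2 * (s + 1) * (s + 3) / 6"
      unfolding c_def using s(1) by (simp add: power2_eq_square)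
    ultimately have "c * (s * (h_star * (s + 3) / 6)) = 1" by simp
    then show ?thesis using c by (simp add: field_simps)
  qed
  have sum_le: "n1 + n2 + n3 \<le> (c * (d1 + d2 + d3) + (s1 + s2 + s3) * (1 / c)) / 2"
    if "n1 \<le> (c * d1 + s1 / c) / 2" "n2 \<le> (c * d2 + s2 / c) / 2" "n3 \<le> (c * d3 + s3 / c) / 2"
    for n1 n2 n3 d1 d2 d3 s1 s2 s3
    using that by (simp add: distrib_left add_divide_distrib)
  have "norm ((u2 - u1) \<times> (v1 + v2)) + norm ((u3 - u2) \<times> (v2 + v3)) + norm ((u1 - u3) \<times> (v3 + v1))
     \<le> (c * (9 * T\<^sup>2) + (12 * k\<^sup>2 + 3 * W\<^sup>2) * (1 / c)) / 2"
    unfolding D[symmetric] S[symmetric]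
    by (intro sum_le pair)
  also have "\<dots> = 3 * s / 2 * (h_star * (s + 1) * T\<^sup>2 + h_star * (s + 3) / 6 * (4 * k\<^sup>2 + W\<^sup>2))"
  proof -
    have "3 * c = s * (h_star * (s + 1))"
      unfolding c_def using s by (simp add: field_simps)
    then have "c * (9 * T\<^sup>2) = 3 * s * (h_star * (s + 1) * T\<^sup>2)" by simp
    then show ?thesis unfolding inv_c by (simp add: algebra_simps)
  qed
  finally have 4: "norm ((u2 - u1) \<times> (v1 + v2)) + norm ((u3 - u2) \<times> (v2 + v3)) + norm ((u1 - u3) \<times> (v3 + v1))
    \<le> 3 * s / 2 * (h_star * (s + 1) * T\<^sup>2 + h_star * (s + 3) / 6 * (4 * k\<^sup>2 + W\<^sup>2))" .
  have 5: "6 * (u1 \<bullet> (u2 \<times> v3) + u2 \<bullet> (u3 \<times> v1) + u3 \<bullet> (u1 \<times> v2) + v1 \<bullet> (v2 \<times> v3))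
     \<le> 9 * s * k * T\<^sup>2 + 9 * s * k * W\<^sup>2 + 18 * s * (q * T * W)"
    unfolding triple_products_mean_decomposition using 1 2 3 unfolding ab by linarith
  have "6 * (3 * s / 2 * (k * (T\<^sup>2 + W\<^sup>2) + 2 * q * T * W))
     = 9 * s * k * T\<^sup>2 + 9 * s * k * W\<^sup>2 + 18 * s * (q * T * W)"
    by (simp add: algebra_simps)
  then have "6 * (u1 \<bullet> (u2 \<times> v3) + u2 \<bullet> (u3 \<times> v1) + u3 \<bullet> (u1 \<times> v2) + v1 \<bullet> (v2 \<times> v3))
     \<le> 6 * (3 * s / 2 * (k * (T\<^sup>2 + W\<^sup>2) + 2 * q * T * W))"
    using 5 by (simp only:)
  then have 6: "u1 \<bullet> (u2 \<times> v3) + u2 \<bullet> (u3 \<times> v1) + u3 \<bullet> (u1 \<times> v2) + v1 \<bullet> (v2 \<times> v3)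
     \<le> 3 * s / 2 * (k * (T\<^sup>2 + W\<^sup>2) + 2 * q * T * W)"
    by (simp only: mult_le_cancel_left_pos zero_less_numeral)
  have "scalar_functional k T W q = (k * (T\<^sup>2 + W\<^sup>2) + 2 * q * T * W)
      + (h_star * (s + 1) * T\<^sup>2 + h_star * (s + 3) / 6 * (4 * k\<^sup>2 + W\<^sup>2))"
    unfolding scalar_functional_def s_def by simp
  then show ?thesis
    unfolding midpoint_functional_def s_def[symmetric] distrib_left using add_mono[OF 6 4]
    by (simp only: distrib_left add.assoc)
qed

text \<open>The hypothesis becomes the constraint of the scalar inequality, since a mean square is
  the squared mean plus the variance. Equality makes every nonnegative term of the scalar gap
  vanish.\<close>

lemma midpoint_functional_bound:
  fixes u1 u2 u3 v1 v2 v3 :: "real^3"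
  assumes "(norm u1)\<^sup>2 + (norm u2)\<^sup>2 + (norm u3)\<^sup>2 + (norm v1)\<^sup>2 + (norm v2)\<^sup>2 + (norm v3)\<^sup>2 = 3"
  shows "midpoint_functional u1 u2 u3 v1 v2 v3 \<le> 9 * h_star"
    and "midpoint_functional u1 u2 u3 v1 v2 v3 = 9 * h_star \<Longrightarrow>
      u1 + u2 + u3 = 0 \<and> v1 = v2 \<and> v2 = v3 \<and> norm v3 = h_star"
proof -
  define k q T W where kqTW:
    "k = norm (v1 + v2 + v3) / 3" "q = norm (u1 + u2 + u3) / 3"
    "T = sqrt (((norm (u1 - u2))\<^sup>2 + (norm (u1 + u2 - 2 *\<^sub>R u3))\<^sup>2 / 3) / 6)"
    "W = sqrt (((norm (v1 - v2))\<^sup>2 + (norm (v1 + v2 - 2 *\<^sub>R v3))\<^sup>2 / 3) / 6)"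
  have k0: "k \<ge> 0" by (simp add: kqTW)
  have T2: "18 * T\<^sup>2 = 3 * (norm (u1 - u2))\<^sup>2 + (norm (u1 + u2 - 2 *\<^sub>R u3))\<^sup>2"
    and W2: "18 * W\<^sup>2 = 3 * (norm (v1 - v2))\<^sup>2 + (norm (v1 + v2 - 2 *\<^sub>R v3))\<^sup>2"
    and K2: "9 * k\<^sup>2 = (norm (v1 + v2 + v3))\<^sup>2" and Q2: "9 * q\<^sup>2 = (norm (u1 + u2 + u3))\<^sup>2"
    unfolding kqTW by (simp_all add: power_divide)
  have "18 * (k\<^sup>2 + T\<^sup>2 + W\<^sup>2 + q\<^sup>2) = 6 * ((norm u1)\<^sup>2 + (norm u2)\<^sup>2 + (norm u3)\<^sup>2 + (norm v1)\<^sup>2 + (norm v2)\<^sup>2 + (norm v3)\<^sup>2)"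
  proof -
    have "18 * (k\<^sup>2 + T\<^sup>2 + W\<^sup>2 + q\<^sup>2) = 2 * (9 * k\<^sup>2) + (18 * T\<^sup>2) + (18 * W\<^sup>2) + 2 * (9 * q\<^sup>2)" by simp
    also have "\<dots> = 6 * ((norm u1)\<^sup>2 + (norm u2)\<^sup>2 + (norm u3)\<^sup>2 + (norm v1)\<^sup>2 + (norm v2)\<^sup>2 + (norm v3)\<^sup>2)"
      unfolding T2 W2 K2 Q2 power2_norm_eq_inner
      by (simp add: inner_commute algebra_simps)
    finally show ?thesis .
  qed
  then have one: "k\<^sup>2 + T\<^sup>2 + W\<^sup>2 + q\<^sup>2 = 1" using assms by simp
  define gap where "gap = (k - h_star)\<^sup>2 * k + (k - h_star)\<^sup>2 * h_star + W\<^sup>2 / 2 + q\<^sup>2 / 5"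
  have "3 * sqrt 3 / 2 * (scalar_functional k T W q + gap) \<le> 3 * sqrt 3 / 2 * (2 * sqrt 3 * h_star)"
    unfolding gap_def by (intro mult_left_mono scalar_functional_bound k0 one) simp
  also have "\<dots> = 9 * h_star" by simp
  finally have main: "midpoint_functional u1 u2 u3 v1 v2 v3 + 3 * sqrt 3 / 2 * gap \<le> 9 * h_star"
    using midpoint_functional_le_scalar[of u1 u2 u3 v1 v2 v3] unfolding kqTW by (simp add: distrib_left)
  have terms: "0 \<le> (k - h_star)\<^sup>2 * k" "0 \<le> (k - h_star)\<^sup>2 * h_star" "0 \<le> W\<^sup>2 / 2" "0 \<le> q\<^sup>2 / 5"
    using k0 h_star_pos by auto
  then have "0 \<le> 3 * sqrt 3 / 2 * gap" unfolding gap_def by (intro mult_nonneg_nonneg) auto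
  then show "midpoint_functional u1 u2 u3 v1 v2 v3 \<le> 9 * h_star" using main by linarith
  assume "midpoint_functional u1 u2 u3 v1 v2 v3 = 9 * h_star"
  then have "3 * sqrt 3 / 2 * gap \<le> 0" using main by linarith
  then have "gap \<le> 0" by (simp add: mult_le_0_iff)
  \<comment> \<open>The summand with factor \<open>h_star\<close> is the useful one: its factor is
    known to be positive, while \<open>k\<close> might be 0.\<close>
  then have "(k - h_star)\<^sup>2 * h_star = 0" "W\<^sup>2 = 0" "q\<^sup>2 = 0"
    using terms unfolding gap_def by linarith+
  then have z: "k = h_star" "W = 0" "q = 0" using h_star_pos by auto
  have "3 * (norm (v1 - v2))\<^sup>2 + (norm (v1 + v2 - 2 *\<^sub>R v3))\<^sup>2 = 0"
    using W2 z(2) by simp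
  then have "norm (v1 - v2) = 0" and "norm (v1 + v2 - 2 *\<^sub>R v3) = 0"
    by (simp_all only: add_nonneg_eq_0_iff zero_le_power2 power_eq_0_iff mult_eq_0_iff
        mult_nonneg_nonneg zero_le_numeral zero_neq_numeral[symmetric] HOL.simp_thms)
  then have v12: "v1 = v2" and "v1 + v2 - 2 *\<^sub>R v3 = 0"
    by (simp_all only: norm_eq_zero right_minus_eq)
  moreover have "v2 + v2 - 2 *\<^sub>R v3 = 2 *\<^sub>R (v2 - v3)"
    by (simp only: scaleR_2 scaleR_diff_right)
  ultimately have v: "v1 = v2" "v2 = v3" by simp_all
  have "v1 + v2 + v3 = 3 *\<^sub>R v3" unfolding v by (simp add: vec_eq_iff)
  then have "k = norm v3" unfolding kqTW(1) by simp
  moreover have "u1 + u2 + u3 = 0" using Q2 z(3) by simp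
  ultimately show "u1 + u2 + u3 = 0 \<and> v1 = v2 \<and> v2 = v3 \<and> norm v3 = h_star"
    using v z(1) by blast
qed

section \<open>Combinatorial equivalence and vertex labellings\<close>

text \<open>Describes facets by the inclusion order of the faces alone, which is all that a
  combinatorial equivalence preserves.\<close>

lemma facet_of_polytope_iff_maximal:
  assumes "polytope P"
  shows "F facet_of P \<longleftrightarrow> F face_of P \<and> F \<noteq> {} \<and> F \<noteq> P \<and>
    (\<forall>G. G face_of P \<longrightarrow> F \<subseteq> G \<longrightarrow> G = F \<or> G = P)"
proof
  assume F: "F facet_of P"
  have "G = F" if G: "G face_of P" "F \<subseteq> G" "G \<noteq> P" for G
  proof -
    have "G \<noteq> {}" using F G by (auto simp: facet_of_def)
    then obtain F' where F': "F' facet_of P" "G \<subseteq> F'"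
      using face_of_polyhedron_subset_facet[OF polytope_imp_polyhedron[OF assms]] G by metis
    have "F face_of F'"
      using F F' G by (meson facet_of_def face_of_imp_subset face_of_subset order_trans)
    moreover have "convex F'" using F' by (meson facet_of_def face_of_imp_convex)
    moreover have "aff_dim F = aff_dim F'" using F F' by (simp add: facet_of_def)
    ultimately have "F = F'" using face_of_aff_dim_lt by force
    then show ?thesis using F' G by auto
  qed
  then show "F face_of P \<and> F \<noteq> {} \<and> F \<noteq> P \<and> (\<forall>G. G face_of P \<longrightarrow> F \<subseteq> G \<longrightarrow> G = F \<or> G = P)"
    using F by (auto simp: facet_of_def)
next
  assume R: "F face_of P \<and> F \<noteq> {} \<and> F \<noteq> P \<and> (\<forall>G. G face_of P \<longrightarrow> F \<subseteq> G \<longrightarrow> G = F \<or> G = P)"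
  then obtain F' where "F' facet_of P" "F \<subseteq> F'"
    using face_of_polyhedron_subset_facet[OF polytope_imp_polyhedron[OF assms]] by metis
  then show "F facet_of P" using R by (metis facet_of_def facet_of_irrefl)
qed

lemma face_of_polytope_hull_vertices:
  assumes "polytope P" "F face_of P"
  shows "F = convex hull (vertices F)"
  unfolding vertices_def using face_of_polytope_polytope[OF assms]
  by (intro Krein_Milman_Minkowski polytope_imp_compact polytope_imp_convex)

lemma vertices_face_of: "F face_of P \<Longrightarrow> vertices F = vertices P \<inter> F"
  by (auto simp: vertices_def extreme_point_of_face)

lemma polytope_vertices_nonempty:
  assumes "polytope P" "F face_of P" "F \<noteq> {}"
  obtains v where "v \<in> vertices P" "v \<in> F"
  using face_of_polytope_hull_vertices[OF assms(1,2)] assms(3) vertices_face_of[OF assms(2)]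
  by (metis Int_iff convex_hull_eq_empty ex_in_conv)

text \<open>An isomorphism of face lattices preserves bottom, top, atoms and coatoms. The atoms are
  the vertices and the coatoms the facets, and a face is the hull of the atoms below it, so the
  induced vertex bijection determines the facets.\<close>

lemma combinatorially_equivalent_facets:
  assumes P: "polytope P" and Q: "polytope Q" and eq: "combinatorially_equivalent P Q"
  obtains g where "bij_betw g (vertices Q) (vertices P)"
    and "{F. F facet_of P} = (\<lambda>G. convex hull (g ` vertices G)) ` {G. G facet_of Q}"
proof -
  obtain f where bij: "bij_betw f {F. F face_of P} {G. G face_of Q}"
    and mono: "\<And>F F'. F face_of P \<Longrightarrow> F' face_of P \<Longrightarrow> F \<subseteq> F' \<longleftrightarrow> f F \<subseteq> f F'"
    using eq unfolding combinatorially_equivalent_def by blast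
  have fQ: "f F face_of Q" if "F face_of P" for F using bij that by (auto simp: bij_betw_def)
  have onto: "\<exists>F. F face_of P \<and> f F = G" if "G face_of Q" for G
    using bij that unfolding bij_betw_def by (metis (mono_tags, lifting) imageE mem_Collect_eq)
  have faceP: "{} face_of P" "P face_of P" and faceQ: "Q face_of Q" "{} face_of Q"
    using P Q by (auto simp: polytope_imp_convex intro: face_of_refl)
  have f_empty: "f F = {} \<longleftrightarrow> F = {}" and f_top: "f F = Q \<longleftrightarrow> F = P" if "F face_of P" for F
  proof -
    obtain E T where "E face_of P" "f E = {}" "T face_of P" "f T = Q" using onto faceQ by metis
    then have "f {} = {}" "f P = Q"
      using mono faceP fQ by (metis bot.extremum_uniqueI empty_subsetI, metis face_of_imp_subset subset_antisym)
    then show "f F = {} \<longleftrightarrow> F = {}" "f F = Q \<longleftrightarrow> F = P"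
      using mono that faceP by (metis subset_empty, metis face_of_imp_subset subset_antisym subset_refl)
  qed
  have "\<exists>w\<in>vertices Q. f {v} = {w}" if v: "v \<in> vertices P" for v
  proof -
    have vP: "{v} face_of P" using v by (simp add: vertices_def face_of_singleton)
    then have "f {v} \<noteq> {}" using f_empty by blast
    \<comment> \<open>The face of \<open>P\<close> corresponding to \<open>{w}\<close> is nonempty
      and contained in \<open>{v}\<close>, hence is \<open>{v}\<close>; so \<open>f {v}\<close> has
      no further point.\<close>
    then obtain w where w: "w \<in> vertices Q" "w \<in> f {v}"
      using polytope_vertices_nonempty[OF Q fQ[OF vP]] by blast
    then have "{w} face_of Q" by (simp add: vertices_def face_of_singleton)
    then obtain G where G: "G face_of P" "f G = {w}" using onto by blast
    then have "G \<subseteq> {v}" "G \<noteq> {}" using mono[OF G(1) vP] w f_empty by auto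
    then show ?thesis using G w by (metis subset_singletonD)
  qed
  then obtain e where e: "\<And>v. v \<in> vertices P \<Longrightarrow> e v \<in> vertices Q \<and> f {v} = {e v}" by metis
  have mem: "e v \<in> f F \<longleftrightarrow> v \<in> F" if "v \<in> vertices P" "F face_of P" for v F
    using mono[of "{v}" F] e[OF that(1)] that by (auto simp: vertices_def face_of_singleton)
  have e_onto: "w \<in> e ` vertices P" if w: "w \<in> vertices Q" for w
  proof -
    have "{w} face_of Q" using w by (simp add: vertices_def face_of_singleton)
    then obtain G where G: "G face_of P" "f G = {w}" using onto by blast
    then obtain v where v: "v \<in> vertices P" "v \<in> G"
      using polytope_vertices_nonempty[OF P G(1)] f_empty[OF G(1)] by blast
    then have "e v = w" using mem[OF v(1) G(1)] G by auto
    then show ?thesis using v by blast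
  qed
  have "inj_on e (vertices P)"
  proof (rule inj_onI)
    fix v v' assume v: "v \<in> vertices P" "v' \<in> vertices P" "e v = e v'"
    then have "v \<in> {v'}" using mem[of v "{v'}"] e[OF v(2)] by (auto simp: vertices_def face_of_singleton)
    then show "v = v'" by simp
  qed
  then have e_bij: "bij_betw e (vertices P) (vertices Q)"
    using e_onto e by (auto simp: bij_betw_def)
  \<comment> \<open>The inverse direction is taken because the labels are given on \<open>Q\<close>
    and have to be carried to \<open>P\<close>.\<close>
  define g where "g = the_inv_into (vertices P) e"
  have g_e: "g (e v) = v" if "v \<in> vertices P" for v
    using that e_bij unfolding g_def bij_betw_def by (simp add: the_inv_into_f_f)
  have "g ` vertices (f F) = vertices F" if F: "F face_of P" for F
  proof -
    have "vertices Q \<inter> f F = e ` (vertices P \<inter> F)"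
    proof
      show "vertices Q \<inter> f F \<subseteq> e ` (vertices P \<inter> F)"
      proof
        fix w assume w: "w \<in> vertices Q \<inter> f F"
        then obtain v where "v \<in> vertices P" "w = e v" using e_onto by blast
        then show "w \<in> e ` (vertices P \<inter> F)" using w mem[OF _ F, of v] by simp
      qed
      show "e ` (vertices P \<inter> F) \<subseteq> vertices Q \<inter> f F"
        using mem[OF _ F] e by auto
    qed
    then have "vertices (f F) = e ` vertices F"
      unfolding vertices_face_of[OF F] vertices_face_of[OF fQ[OF F]] .
    moreover have "vertices F \<subseteq> vertices P" using vertices_face_of[OF F] by auto
    ultimately show ?thesis using g_e by force
  qed
  then have hull: "convex hull (g ` vertices (f F)) = F" if "F face_of P" for F
    using face_of_polytope_hull_vertices[OF P] that by metis
  have facet: "f F facet_of Q \<longleftrightarrow> F facet_of P" if F: "F face_of P" for F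
  proof -
    have all: "(\<forall>G. G face_of Q \<longrightarrow> R G) \<longleftrightarrow> (\<forall>G. G face_of P \<longrightarrow> R (f G))" for R
      using onto fQ by auto
    have inj: "f G = f F \<longleftrightarrow> G = F" if "G face_of P" for G
      unfolding set_eq_subset using mono[OF that F] mono[OF F that] by simp
    have "(\<forall>G. G face_of Q \<longrightarrow> f F \<subseteq> G \<longrightarrow> G = f F \<or> G = Q)
       \<longleftrightarrow> (\<forall>G. G face_of P \<longrightarrow> F \<subseteq> G \<longrightarrow> G = F \<or> G = P)"
      unfolding all using mono[OF F] inj f_top by simp
    then show ?thesis
      unfolding facet_of_polytope_iff_maximal[OF P] facet_of_polytope_iff_maximal[OF Q]
      using F fQ[OF F] f_empty[OF F] f_top[OF F] by simp
  qed
  have "{F. F facet_of P} = (\<lambda>G. convex hull (g ` vertices G)) ` {G. G facet_of Q}"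
  proof (intro equalityI subsetI)
    fix F assume "F \<in> {F. F facet_of P}"
    then have F: "F facet_of P" "F face_of P" by (auto simp: facet_of_def)
    then have "f F facet_of Q" "F = convex hull (g ` vertices (f F))" using facet hull by auto
    then show "F \<in> (\<lambda>G. convex hull (g ` vertices G)) ` {G. G facet_of Q}" by blast
  next
    fix F assume "F \<in> (\<lambda>G. convex hull (g ` vertices G)) ` {G. G facet_of Q}"
    then obtain G where G: "G facet_of Q" "F = convex hull (g ` vertices G)" by blast
    then obtain F' where "F' face_of P" "f F' = G" using onto by (meson facet_of_imp_face_of)
    then show "F \<in> {F. F facet_of P}" using G facet hull by auto
  qed
  moreover have "bij_betw g (vertices Q) (vertices P)"
    unfolding g_def by (rule bij_betw_the_inv_into[OF e_bij])
  ultimately show ?thesis using that by blast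
qed

definition apex_triangles :: "'a \<Rightarrow> 'a \<Rightarrow> 'a \<Rightarrow> 'a \<Rightarrow> 'a \<Rightarrow> 'a set set" where
  "apex_triangles a x y x' y' = {{a, x, y}, {a, y, y'}, {a, y', x'}, {a, x', x}}"

text \<open>Facets are recorded by their vertex sets, so that a relabelling acts on them by taking
  images.\<close>

definition prism_triangles :: "'a \<Rightarrow> 'a \<Rightarrow> 'a \<Rightarrow> 'a \<Rightarrow> 'a \<Rightarrow> 'a \<Rightarrow> 'a \<Rightarrow> 'a \<Rightarrow> 'a \<Rightarrow> 'a set set" where
  "prism_triangles x1 x2 x3 y1 y2 y3 a1 a2 a3 =
     {{x1, x2, x3}, {y1, y2, y3}} \<union> apex_triangles a1 x1 y1 x2 y2
      \<union> apex_triangles a2 x2 y2 x3 y3 \<union> apex_triangles a3 x3 y3 x1 y1"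

lemma prism_triangles_image:
  "prism_triangles (g x1) (g x2) (g x3) (g y1) (g y2) (g y3) (g a1) (g a2) (g a3)
     = image g ` prism_triangles x1 x2 x3 y1 y2 y3 a1 a2 a3"
  by (simp add: prism_triangles_def apex_triangles_def)

text \<open>The labels of the model \<open>Q\<close> are carried to \<open>P\<close> by the vertex
  bijection; the facets follow because each facet of \<open>Q\<close> has exactly its three labels
  as vertices.\<close>

lemma TTP_class_labelling:
  assumes "P \<in> TTP_class"
  obtains x1 x2 x3 y1 y2 y3 a1 a2 a3 where
    "distinct [x1, x2, x3, y1, y2, y3, a1, a2, a3]"
    "vertices P = {x1, x2, x3, y1, y2, y3, a1, a2, a3}"
    "{F. F facet_of P} = (hull) convex ` prism_triangles x1 x2 x3 y1 y2 y3 a1 a2 a3"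
proof -
  obtain Q where P: "polytope P" and Q: "triaugmented_triangular_prism Q" and eq: "combinatorially_equivalent P Q"
    using assms by (auto simp: TTP_class_def P9_def)
  have pQ: "polytope Q"
    using Q by (auto simp: triaugmented_triangular_prism_def simplicial_3polytope_def)
  obtain x y a :: "3 \<Rightarrow> real^3" where V: "vertices Q = range x \<union> range y \<union> range a" and card: "card (vertices Q) = 9"
    and F: "{F. F facet_of Q} =
          {convex hull {x 1, x 2, x 3}, convex hull {y 1, y 2, y 3}} \<union>
          (\<Union>i. {convex hull {a i, x i, y i},
                 convex hull {a i, y i, y (i + 1)},
                 convex hull {a i, y (i + 1), x (i + 1)},
                 convex hull {a i, x (i + 1), x i}})"
    using Q unfolding triaugmented_triangular_prism_def by blast
  let ?T = "prism_triangles (x 1) (x 2) (x 3) (y 1) (y 2) (y 3) (a 1) (a 2) (a 3)"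
  have cyc: "(1::3) + 1 = 2" "(2::3) + 1 = 3" "(3::3) + 1 = 1" by simp_all
  have F': "{F. F facet_of Q} = (hull) convex ` ?T"
    unfolding F UNIV_3 prism_triangles_def apex_triangles_def
    by (simp only: Union_insert Union_empty cyc image_insert image_empty image_Un Un_assoc Un_empty_right)
  have V': "vertices Q = set [x 1, x 2, x 3, y 1, y 2, y 3, a 1, a 2, a 3]"
    unfolding V UNIV_3 by auto
  have dist: "distinct [x 1, x 2, x 3, y 1, y 2, y 3, a 1, a 2, a 3]"
    by (rule card_distinct) (use card V' in simp)
  \<comment> \<open>A point of \<open>S\<close> is a vertex of \<open>Q\<close> lying in the facet,
    hence extreme in that facet as well.\<close>
  have hullT: "vertices (convex hull S) = S" if "S \<in> ?T" for S
  proof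
    show "vertices (convex hull S) \<subseteq> S"
      unfolding vertices_def by (rule extreme_points_of_convex_hull)
    have "convex hull S facet_of Q" using that F' by blast
    then have "convex hull S face_of Q" by (simp add: facet_of_def)
    moreover have "S \<subseteq> vertices Q" using that unfolding V' prism_triangles_def apex_triangles_def by auto
    ultimately show "S \<subseteq> vertices (convex hull S)"
      using vertices_face_of by (metis Int_greatest hull_subset)
  qed
  obtain g where g: "bij_betw g (vertices Q) (vertices P)"
    and gF: "{F. F facet_of P} = (\<lambda>G. convex hull (g ` vertices G)) ` {G. G facet_of Q}"
    using combinatorially_equivalent_facets[OF P pQ eq] by blast
  show ?thesis
  proof
    show "distinct [g (x 1), g (x 2), g (x 3), g (y 1), g (y 2), g (y 3), g (a 1), g (a 2), g (a 3)]"
      using dist g distinct_map[of g "[x 1, x 2, x 3, y 1, y 2, y 3, a 1, a 2, a 3]"] V'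
      by (simp add: bij_betw_def)
    show "vertices P = {g (x 1), g (x 2), g (x 3), g (y 1), g (y 2), g (y 3), g (a 1), g (a 2), g (a 3)}"
      using g V' unfolding bij_betw_def by auto
    show "{F. F facet_of P} = (hull) convex `
        prism_triangles (g (x 1)) (g (x 2)) (g (x 3)) (g (y 1)) (g (y 2)) (g (y 3)) (g (a 1)) (g (a 2)) (g (a 3))"
      unfolding gF F' prism_triangles_image image_image using hullT by auto
  qed
qed

section \<open>Tetrahedra and coherent orientation\<close>

definition signed_volume :: "real^3 \<Rightarrow> real^3 \<Rightarrow> real^3 \<Rightarrow> real^3 \<Rightarrow> real" where
  "signed_volume p b c d = (b - p) \<bullet> ((c - p) \<times> (d - p)) / 6"

text \<open>The tetrahedron is an affine image of the standard simplex, which has volume 1/6, and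
  the determinant of the linear part is the triple product.\<close>

lemma measure_tetrahedron:
  "measure lebesgue (convex hull {p, b, c, d}) = \<bar>signed_volume p b c d\<bar>"
proof -
  define f :: "real^3 \<Rightarrow> real^3" where "f v = v $ 1 *\<^sub>R (b - p) + v $ 2 *\<^sub>R (c - p) + v $ 3 *\<^sub>R (d - p)" for v
  define std :: "(real^3) set" where "std = convex hull (insert 0 Basis)"
  have lin: "linear f"
    unfolding f_def by (rule linearI) (simp_all add: algebra_simps)
  have Basis_eq: "(Basis :: (real^3) set) = {axis 1 1, axis 2 1, axis 3 1}"
    unfolding Basis_vec_def UNIV_3 by auto
  have f_Basis: "f ` insert 0 Basis = {0, b - p, c - p, d - p}"
    unfolding Basis_eq f_def by (simp add: axis_def)
  have compact: "compact std"
    unfolding std_def by (intro finite_imp_compact_convex_hull) auto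
  have "convex hull {p, b, c, d} = convex hull ((+) p ` f ` insert 0 Basis)"
    unfolding f_Basis by simp
  also have "\<dots> = (+) p ` f ` std"
    unfolding std_def by (simp only: convex_hull_translation convex_hull_linear_image[OF lin])
  finally have "measure lebesgue (convex hull {p, b, c, d}) = measure lebesgue (f ` std)"
    by (simp add: measure_translation)
  also have "\<dots> = \<bar>det (matrix f)\<bar> * measure lebesgue std"
    using compact by (intro measure_lebesgue_linear_transformation lin)
      (auto dest: compact_imp_bounded compact_imp_closed)
  also have "measure lebesgue std = measure lborel std"
    using compact by (intro measure_completion) (auto dest: compact_imp_closed)
  also have "\<dots> = 1 / 6"
    unfolding std_def content_std_simplex by (simp add: fact_numeral)
  also have "det (matrix f) = (b - p) \<bullet> ((c - p) \<times> (d - p))"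
    unfolding det_3 matrix_def f_def by (simp add: axis_def cross3_simps)
  finally show ?thesis by (simp add: signed_volume_def)
qed

text \<open>The ray from \<open>p\<close> through \<open>z\<close> leaves \<open>P\<close> at or
  beyond \<open>z\<close>, at a frontier point that lies on some facet.\<close>

lemma polytope_subset_cones_over_facets:
  fixes P :: "'a::euclidean_space set"
  assumes P: "polytope P" and p: "p \<in> interior P"
  shows "P \<subseteq> (\<Union>F\<in>{F. F facet_of P}. convex hull (insert p F))"
proof
  fix z assume z: "z \<in> P"
  \<comment> \<open>For \<open>z = p\<close> an arbitrary nonzero direction is taken; it still
    yields some facet, and \<open>p\<close> lies in the cone over it.\<close>
  obtain l where l: "l \<noteq> 0" "z \<noteq> p \<Longrightarrow> l = z - p"
    by (cases "z = p") (use nonempty_Basis nonzero_Basis in \<open>auto intro: that\<close>)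
  have cl: "closure P = P" using P polytope_imp_closed closure_closed by blast
  obtain d where d: "0 < d" "p + d *\<^sub>R l \<in> frontier P"
    using ray_to_frontier[OF polytope_imp_bounded[OF P] p l(1)] by blast
  have "interior P \<noteq> {}" using p by auto
  then have "frontier P = rel_frontier P"
    by (simp add: frontier_def rel_frontier_def rel_interior_nonempty_interior)
  then obtain F where F: "F facet_of P" "p + d *\<^sub>R l \<in> F"
    using d rel_frontier_of_polyhedron[OF polytope_imp_polyhedron[OF P]] by auto
  have "z \<in> convex hull (insert p F)"
  proof (cases "z = p")
    case True
    then show ?thesis by (simp add: hull_inc)
  next
    case False
    then have l: "l = z - p" using l by blast
    \<comment> \<open>Otherwise the exit point would lie strictly between the interior point
      \<open>p\<close> and \<open>z \<in> P\<close>, and so be interior itself.\<close>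
    have "d \<ge> 1"
    proof (rule ccontr)
      assume "\<not> d \<ge> 1"
      then have "p + d *\<^sub>R l \<in> open_segment p z"
        unfolding in_segment l using False d(1)
        by (auto intro!: exI[of _ d] simp: algebra_simps)
      then have "p + d *\<^sub>R l \<in> interior P"
        using in_interior_closure_convex_segment[OF polytope_imp_convex[OF P] p] z cl by blast
      then show False using d(2) by (simp add: frontier_def)
    qed
    then have "z = (1 - 1 / d) *\<^sub>R p + (1 / d) *\<^sub>R (p + d *\<^sub>R l)"
      unfolding l by (simp add: algebra_simps)
    moreover have "p \<in> convex hull (insert p F)" "p + d *\<^sub>R l \<in> convex hull (insert p F)"
      using F(2) by (auto intro: hull_inc)
    ultimately show ?thesis
      using \<open>d \<ge> 1\<close> convexD_alt[OF convex_convex_hull, of p "insert p F" "p + d *\<^sub>R l" "1 / d"] by simp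
  qed
  then show "z \<in> (\<Union>F\<in>{F. F facet_of P}. convex hull (insert p F))" using F by blast
qed

text \<open>As a function of its apex, the signed volume over a facet is a nonzero multiple of the
  distance functional of the supporting plane, and both \<open>p\<close> and \<open>e\<close> lie
  strictly on the inner side.\<close>

lemma signed_volume_same_side:
  assumes P: "polytope P" and p: "p \<in> interior P" and F: "convex hull {b, c, d} facet_of P"
    and e: "e \<in> vertices P" "e \<notin> {b, c, d}"
  shows "signed_volume p b c d * signed_volume e b c d > 0"
proof -
  obtain n \<beta> where n: "n \<noteq> 0" "P \<subseteq> {x. n \<bullet> x \<le> \<beta>}" "convex hull {b, c, d} = P \<inter> {x. n \<bullet> x = \<beta>}"
    using facet_of_polyhedron[OF polytope_imp_polyhedron[OF P] F] by metis
  have "b \<in> convex hull {b, c, d}" "c \<in> convex hull {b, c, d}" "d \<in> convex hull {b, c, d}"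
    by (auto intro: hull_inc)
  then have bcd: "n \<bullet> b = \<beta>" "n \<bullet> c = \<beta>" "n \<bullet> d = \<beta>" using n by auto
  have "n \<bullet> p < \<beta>"
    using interior_mono[OF n(2)] p n(1) by (auto simp: interior_halfspace_le)
  moreover have "n \<bullet> e < \<beta>"
  proof -
    have "e \<notin> convex hull {b, c, d}"
      using e extreme_point_of_face[OF facet_of_imp_face_of[OF F]] extreme_point_of_convex_hull
      by (fastforce simp: vertices_def)
    moreover have "e \<in> P" using e by (simp add: vertices_def extreme_point_of_def)
    ultimately show ?thesis using n by force
  qed
  ultimately have sides: "(\<beta> - n \<bullet> p) * (\<beta> - n \<bullet> e) > 0" by simp
  \<comment> \<open>\<open>N\<close> is the facet normal computed from the edges. It is parallel to
    the supporting normal \<open>n\<close>, and nonzero since a facet of the solid \<open>P\<close>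
    has dimension 2.\<close>
  define N where "N = (c - b) \<times> (d - b)"
  have vol: "signed_volume z b c d = (b - z) \<bullet> N / 6" for z
    unfolding signed_volume_def N_def by (simp add: cross3_simps)
  have "n \<times> N = (n \<bullet> (d - b)) *\<^sub>R (c - b) - (n \<bullet> (c - b)) *\<^sub>R (d - b)"
    unfolding N_def by (simp add: cross3_simps forall_3)
  also have "\<dots> = 0" by (simp add: inner_diff_right bcd)
  finally have "0 = n \<times> (n \<times> N)" by simp
  also have "\<dots> = (n \<bullet> N) *\<^sub>R n - (n \<bullet> n) *\<^sub>R N"
    by (simp add: cross3_simps forall_3)
  finally have par: "(n \<bullet> n) *\<^sub>R N = (n \<bullet> N) *\<^sub>R n" by simp
  have nn: "n \<bullet> n > 0" using n by simp
  have "N \<noteq> 0"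
  proof
    assume "N = 0"
    then have "collinear {0, c - b, d - b}" by (simp add: N_def cross_eq_0)
    then have "collinear {b, c, d}"
      using collinear_3[of c b d] by (simp add: insert_commute)
    then have "aff_dim (convex hull {b, c, d}) \<le> 1" by (simp add: collinear_aff_dim aff_dim_convex_hull)
    moreover have "aff_dim P = 3" using p aff_dim_nonempty_interior[of P] by auto
    ultimately show False using F by (simp add: facet_of_def)
  qed
  then have "n \<bullet> N \<noteq> 0" using par nn by auto
  have z: "(n \<bullet> n) * ((b - z) \<bullet> N) = (n \<bullet> N) * (\<beta> - n \<bullet> z)" for z
  proof -
    have "(n \<bullet> n) * ((b - z) \<bullet> N) = (b - z) \<bullet> ((n \<bullet> n) *\<^sub>R N)" by simp
    also have "\<dots> = (n \<bullet> N) * (\<beta> - n \<bullet> z)"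
      unfolding par using bcd by (simp add: inner_commute inner_diff_right)
    finally show ?thesis .
  qed
  have "((n \<bullet> n) * ((b - p) \<bullet> N)) * ((n \<bullet> n) * ((b - e) \<bullet> N)) = (n \<bullet> N)\<^sup>2 * ((\<beta> - n \<bullet> p) * (\<beta> - n \<bullet> e))"
    unfolding z by (simp add: power2_eq_square)
  also have "\<dots> > 0" using sides \<open>n \<bullet> N \<noteq> 0\<close> by simp
  finally have "(n \<bullet> n)\<^sup>2 * (((b - p) \<bullet> N) * ((b - e) \<bullet> N)) > 0" by (simp add: power2_eq_square mult_ac)
  then have "((b - p) \<bullet> N) * ((b - e) \<bullet> N) > 0" using nn by (simp add: zero_less_mult_iff)
  then show ?thesis unfolding vol by simp
qed

text \<open>Both signs are compared with the orientation of the tetrahedron spanned by the two facets.\<close>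

lemma signed_volume_adjacent_facets:
  assumes P: "polytope P" "p \<in> interior P" and pos: "0 < signed_volume p b c d"
    and F: "convex hull {b, c, d} facet_of P" "convex hull {c, b, e} facet_of P"
    and v: "d \<in> vertices P" "e \<in> vertices P" "distinct [b, c, d, e]"
  shows "0 < signed_volume p c b e"
proof -
  have "signed_volume d c b e = signed_volume e b c d"
    unfolding signed_volume_def by (simp add: cross3_simps)
  moreover have "0 < signed_volume p b c d * signed_volume e b c d"
    using v by (intro signed_volume_same_side[OF P F(1)]) auto
  moreover have "0 < signed_volume p c b e * signed_volume d c b e"
    using v by (intro signed_volume_same_side[OF P F(2)]) auto
  ultimately show ?thesis using pos by (auto simp: zero_less_mult_iff)
qed

lemma signed_volume_rotate: "signed_volume p b c d = signed_volume p c d b"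
  and signed_volume_swap: "signed_volume p b c d = - signed_volume p c b d"
proof -
  have "(b - p) \<bullet> ((c - p) \<times> (d - p)) = (c - p) \<bullet> ((d - p) \<times> (b - p))"
    "(b - p) \<bullet> ((c - p) \<times> (d - p)) = - ((c - p) \<bullet> ((b - p) \<times> (d - p)))"
    by (simp_all add: cross3_simps)
  then show "signed_volume p b c d = signed_volume p c d b" "signed_volume p b c d = - signed_volume p c b d"
    unfolding signed_volume_def by simp_all
qed

section \<open>Volume of a labelled polytope bounded by its oriented facets\<close>

lemma emeasure_UN_list_le:
  "(\<And>x. x \<in> set L \<Longrightarrow> A x \<in> sets M) \<Longrightarrow> emeasure M (\<Union>x\<in>set L. A x) \<le> (\<Sum>x\<leftarrow>L. emeasure M (A x))"
proof (induction L)
  case (Cons a L)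
  have "emeasure M (A a \<union> (\<Union>x\<in>set L. A x)) \<le> emeasure M (A a) + emeasure M (\<Union>x\<in>set L. A x)"
    using Cons.prems by (intro emeasure_subadditive sets.finite_UN) auto
  also have "\<dots> \<le> emeasure M (A a) + (\<Sum>x\<leftarrow>L. emeasure M (A x))"
    using Cons by (intro add_left_mono) auto
  finally show ?case by simp
qed simp

text \<open>Six times the signed volume: the sum of the determinants of the 14 oriented facets, where the
  four facets around \<open>a\<^sub>i\<close> combine to a product with the cross product of the diagonals.\<close>

definition ttp_functional ::
  "real^3 \<Rightarrow> real^3 \<Rightarrow> real^3 \<Rightarrow> real^3 \<Rightarrow> real^3 \<Rightarrow> real^3 \<Rightarrow> real^3 \<Rightarrow> real^3 \<Rightarrow> real^3 \<Rightarrow> real" where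
  "ttp_functional x1 x2 x3 y1 y2 y3 a1 a2 a3 =
     x1 \<bullet> (x2 \<times> x3) - y1 \<bullet> (y2 \<times> y3) + a1 \<bullet> ((x1 - y2) \<times> (y1 - x2))
     + a2 \<bullet> ((x2 - y3) \<times> (y2 - x3)) + a3 \<bullet> ((x3 - y1) \<times> (y3 - x1))"

lemma apex_triangles_reflect: "apex_triangles a x' y' x y = apex_triangles a x y x' y'"
  unfolding apex_triangles_def by (simp add: insert_commute)

text \<open>Exchanging the indices 1 and 2 fixes \<open>a1\<close>, which sits between them, and
  swaps \<open>a2\<close> with \<open>a3\<close>. This symmetry of the combinatorial type reverses
  the orientation.\<close>

lemma prism_triangles_reflect:
  "prism_triangles x2 x1 x3 y2 y1 y3 a1 a3 a2 = prism_triangles x1 x2 x3 y1 y2 y3 a1 a2 a3"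
proof -
  have "{x2, x1, x3} = {x1, x2, x3}" "{y2, y1, y3} = {y1, y2, y3}"
    by (simp_all add: insert_commute)
  then show ?thesis
    unfolding prism_triangles_def apex_triangles_reflect[of _ x2 y2 x1 y1]
      apex_triangles_reflect[of _ x1 y1 x3 y3] apex_triangles_reflect[of _ x3 y3 x2 y2]
    by (simp only: Un_ac)
qed

text \<open>The signed volume over \<open>x1\<close>, \<open>x2\<close>, \<open>x3\<close> does not
  vanish, by comparison with the apex \<open>a1\<close>; if it is negative, the reflected labelling
  is used.\<close>

lemma TTP_class_oriented_labelling:
  assumes "P \<in> TTP_class" and p: "p \<in> interior P"
  obtains x1 x2 x3 y1 y2 y3 a1 a2 a3 where
    "distinct [x1, x2, x3, y1, y2, y3, a1, a2, a3]"
    "vertices P = {x1, x2, x3, y1, y2, y3, a1, a2, a3}"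
    "{F. F facet_of P} = (hull) convex ` prism_triangles x1 x2 x3 y1 y2 y3 a1 a2 a3"
    "0 < signed_volume p x1 x2 x3"
proof -
  obtain x1 x2 x3 y1 y2 y3 a1 a2 a3 where lab:
    "distinct [x1, x2, x3, y1, y2, y3, a1, a2, a3]"
    "vertices P = {x1, x2, x3, y1, y2, y3, a1, a2, a3}"
    "{F. F facet_of P} = (hull) convex ` prism_triangles x1 x2 x3 y1 y2 y3 a1 a2 a3"
    by (rule TTP_class_labelling[OF assms(1)])
  have P: "polytope P" using assms by (simp add: TTP_class_def P9_def)
  have "convex hull {x1, x2, x3} facet_of P"
  proof -
    have "{x1, x2, x3} \<in> prism_triangles x1 x2 x3 y1 y2 y3 a1 a2 a3" by (simp add: prism_triangles_def)
    then have "convex hull {x1, x2, x3} \<in> {F. F facet_of P}" unfolding lab(3) by (rule imageI)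
    then show ?thesis by (rule CollectD)
  qed
  then have "signed_volume p x1 x2 x3 * signed_volume a1 x1 x2 x3 > 0"
    using lab(1,2) by (intro signed_volume_same_side[OF P p]) auto
  then have "signed_volume p x1 x2 x3 \<noteq> 0" by (metis less_irrefl mult_zero_left)
  then consider "0 < signed_volume p x1 x2 x3" | "0 < signed_volume p x2 x1 x3"
    using signed_volume_swap[of p x1 x2 x3] by linarith
  then show ?thesis
  proof cases
    case 1
    show ?thesis by (rule that[OF lab 1])
  next
    case 2
    show ?thesis
    proof (rule that)
      show "distinct [x2, x1, x3, y2, y1, y3, a1, a3, a2]" 
        using lab(1) by (simp add: eq_commute[of x2 x1] eq_commute[of y2 y1] eq_commute[of a3 a2])
      show "vertices P = {x2, x1, x3, y2, y1, y3, a1, a3, a2}"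
        unfolding lab(2) by (simp only: insert_commute)
      show "{F. F facet_of P} = (hull) convex ` prism_triangles x2 x1 x3 y2 y1 y3 a1 a3 a2"
        unfolding prism_triangles_reflect[of x2 x1 x3 y2 y1 y3 a1 a3 a2] by (rule lab(3))
    qed (rule 2)
  qed
qed

text \<open>The 14 triangles form a closed oriented surface: each edge is traversed once in either
  direction, so all terms containing \<open>p\<close> cancel.\<close>

lemma sum_signed_volumes:
  "6 * (signed_volume p x1 x2 x3 + signed_volume p y2 y1 y3
   + (signed_volume p a1 x1 y1 + signed_volume p a1 y1 y2 + signed_volume p a1 y2 x2 + signed_volume p a1 x2 x1)
   + (signed_volume p a2 x2 y2 + signed_volume p a2 y2 y3 + signed_volume p a2 y3 x3 + signed_volume p a2 x3 x2)
   + (signed_volume p a3 x3 y3 + signed_volume p a3 y3 y1 + signed_volume p a3 y1 x1 + signed_volume p a3 x1 x3))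
   = ttp_functional x1 x2 x3 y1 y2 y3 a1 a2 a3"
proof -
  have vol: "6 * signed_volume p b c d = b \<bullet> (c \<times> d) - p \<bullet> (b \<times> c) - p \<bullet> (c \<times> d) - p \<bullet> (d \<times> b)" for b c d
  proof -
    have "(b - p) \<bullet> ((c - p) \<times> (d - p)) = b \<bullet> (c \<times> d) - p \<bullet> (b \<times> c) - p \<bullet> (c \<times> d) - p \<bullet> (d \<times> b)"
      by (simp add: cross3_simps)
    then show ?thesis unfolding signed_volume_def by simp
  qed
  have skew: "p \<bullet> (c \<times> b) = - (p \<bullet> (b \<times> c))" for b c
    by (metis cross_skew inner_minus_right)
  have triple: "y2 \<bullet> (y1 \<times> y3) = - (y1 \<bullet> (y2 \<times> y3))"
    by (simp add: cross3_simps)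
  have quad: "a \<bullet> ((x - y') \<times> (y - x')) = a \<bullet> (x \<times> y) + a \<bullet> (y \<times> y') + a \<bullet> (y' \<times> x') + a \<bullet> (x' \<times> x)" for a x y x' y'
    by (simp add: cross3_simps)
  show ?thesis
    \<comment> \<open>The instances of \<open>skew\<close> bring both traversals of an edge to the
      same cross product, after which the cancellation is linear.\<close>
    unfolding ttp_functional_def quad distrib_left vol triple
      skew[of y1 x1] skew[of y2 x2] skew[of y3 x3]
      skew[of x2 x1] skew[of x3 x2] skew[of x3 x1] skew[of y2 y1] skew[of y3 y2] skew[of y3 y1]
      skew[of a1 x1] skew[of a1 x2] skew[of a1 y1] skew[of a1 y2]
      skew[of a2 x2] skew[of a2 x3] skew[of a2 y2] skew[of a2 y3]
      skew[of a3 x3] skew[of a3 x1] skew[of a3 y3] skew[of a3 y1]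
    by argo
qed

text \<open>Positivity spreads from the top triangle across edges to all 14 facets, so the volumes
  of the cones that cover \<open>P\<close> equal their signed volumes, and subadditivity gives the
  bound.\<close>

lemma measure_le_ttp_functional:
  assumes P: "polytope P" and p: "p \<in> interior P"
    and dist: "distinct [x1, x2, x3, y1, y2, y3, a1, a2, a3]"
    and V: "vertices P = {x1, x2, x3, y1, y2, y3, a1, a2, a3}"
    and F: "{F. F facet_of P} = (hull) convex ` prism_triangles x1 x2 x3 y1 y2 y3 a1 a2 a3"
    and pos: "0 < signed_volume p x1 x2 x3"
  shows "6 * measure lebesgue P \<le> ttp_functional x1 x2 x3 y1 y2 y3 a1 a2 a3"
proof -
  let ?T = "prism_triangles x1 x2 x3 y1 y2 y3 a1 a2 a3"
  have adj: "0 < signed_volume p c b e"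
    if "0 < signed_volume p b c d" "{b, c, d} \<in> ?T" "{c, b, e} \<in> ?T" "d \<in> vertices P" "e \<in> vertices P"
      "distinct [b, c, d, e]" for b c d e
  proof -
    have "convex hull S facet_of P" if "S \<in> ?T" for S
    proof -
      have "convex hull S \<in> {F. F facet_of P}" unfolding F using that by (rule imageI)
      then show ?thesis by (rule CollectD)
    qed
    then show ?thesis using that by (intro signed_volume_adjacent_facets[OF P p that(1)]) simp_all
  qed
  \<comment> \<open>From the triangle \<open>x\<close>, \<open>x'\<close>, \<open>x''\<close> one
    crosses the edge between \<open>x\<close> and \<open>x'\<close> and then walks around the apex
    \<open>a\<close>, each crossing being one use of \<open>adj\<close>.\<close>
  have block: "0 < signed_volume p a x y \<and> 0 < signed_volume p a y y' \<and> 0 < signed_volume p a y' x' \<and> 0 < signed_volume p a x' x"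
    if pos: "0 < signed_volume p x x' x''" and T: "{x, x', x''} \<in> ?T" "apex_triangles a x y x' y' \<subseteq> ?T"
      and V: "x \<in> vertices P" "x' \<in> vertices P" "x'' \<in> vertices P" "y \<in> vertices P" "y' \<in> vertices P" "a \<in> vertices P"
      and dist: "distinct [x, x', x'', y, y', a]" for x x' x'' y y' a
  proof -
    have "x \<noteq> x'" "x \<noteq> x''" "x \<noteq> y" "x \<noteq> y'" "x \<noteq> a" "x' \<noteq> x''" "x' \<noteq> y" "x' \<noteq> y'" "x' \<noteq> a"
      "x'' \<noteq> y" "x'' \<noteq> y'" "x'' \<noteq> a" "y \<noteq> y'" "y \<noteq> a" "y' \<noteq> a"
      using dist by simp_all
    note ne = this this[symmetric]
    have 1: "0 < signed_volume p x' x a"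
      using pos by (rule adj) (use T V in \<open>simp_all add: ne apex_triangles_def insert_commute\<close>)
    then have "0 < signed_volume p x a x'" by (simp only: signed_volume_rotate[of p x'])
    then have 2: "0 < signed_volume p a x y"
      by (rule adj) (use T V in \<open>simp_all add: ne apex_triangles_def insert_commute\<close>)
    then have "0 < signed_volume p y a x" by (simp only: signed_volume_rotate[of p y])
    then have 3: "0 < signed_volume p a y y'"
      by (rule adj) (use T V in \<open>simp_all add: ne apex_triangles_def insert_commute\<close>)
    then have "0 < signed_volume p y' a y" by (simp only: signed_volume_rotate[of p y'])
    then have 4: "0 < signed_volume p a y' x'"
      by (rule adj) (use T V in \<open>simp_all add: ne apex_triangles_def insert_commute\<close>)
    have "0 < signed_volume p a x' x" using 1 by (simp only: signed_volume_rotate[of p a])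
    with 2 3 4 show ?thesis by blast
  qed
  have T: "{x1, x2, x3} \<in> ?T" "{x2, x3, x1} \<in> ?T" "{x3, x1, x2} \<in> ?T" "{y2, y1, y3} \<in> ?T"
    "apex_triangles a1 x1 y1 x2 y2 \<subseteq> ?T" "apex_triangles a2 x2 y2 x3 y3 \<subseteq> ?T" "apex_triangles a3 x3 y3 x1 y1 \<subseteq> ?T"
    unfolding prism_triangles_def by (auto simp: insert_commute)
  then have T': "{y1, y2, a1} \<in> ?T" by (auto simp: apex_triangles_def insert_commute)
  have pos': "0 < signed_volume p x2 x3 x1" "0 < signed_volume p x3 x1 x2"
    using pos signed_volume_rotate[of p x1 x2 x3] signed_volume_rotate[of p x2 x3 x1] by simp_all
  have "x1 \<noteq> x2" "x1 \<noteq> x3" "x2 \<noteq> x3" "y1 \<noteq> y2" "y1 \<noteq> y3" "y2 \<noteq> y3" "y1 \<noteq> a1" "y2 \<noteq> a1" "y3 \<noteq> a1"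
    using dist by simp_all
  note ne = this this[symmetric]
  have b1: "0 < signed_volume p a1 x1 y1 \<and> 0 < signed_volume p a1 y1 y2 \<and> 0 < signed_volume p a1 y2 x2 \<and> 0 < signed_volume p a1 x2 x1"
    using dist by (intro block[OF pos]) (simp_all add: T V ne)
  have b2: "0 < signed_volume p a2 x2 y2 \<and> 0 < signed_volume p a2 y2 y3 \<and> 0 < signed_volume p a2 y3 x3 \<and> 0 < signed_volume p a2 x3 x2"
    using dist by (intro block[OF pos'(1)]) (simp_all add: T V ne)
  have b3: "0 < signed_volume p a3 x3 y3 \<and> 0 < signed_volume p a3 y3 y1 \<and> 0 < signed_volume p a3 y1 x1 \<and> 0 < signed_volume p a3 x1 x3"
    using dist by (intro block[OF pos'(2)]) (simp_all add: T V ne)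
  have "0 < signed_volume p y1 y2 a1" using b1 signed_volume_rotate[of p a1 y1 y2] by simp
  \<comment> \<open>The bottom triangle is reached from the first block across the edge between
    \<open>y1\<close> and \<open>y2\<close>, which reverses the order of these two.\<close>
  then have yy: "0 < signed_volume p y2 y1 y3"
    by (rule adj) (simp_all add: T T' V ne)
  \<comment> \<open>Every facet is listed in its positive orientation, so the absolute values in
    \<open>measure_tetrahedron\<close> disappear. As a sum over a list unfolds directly,
    distinctness of the cones does not arise.\<close>
  define L where "L = [(a3, x3, y3), (a3, y3, y1), (a3, y1, x1), (a3, x1, x3),
    (a2, x2, y2), (a2, y2, y3), (a2, y3, x3), (a2, x3, x2),
    (a1, x1, y1), (a1, y1, y2), (a1, y2, x2), (a1, x2, x1), (x1, x2, x3), (y2, y1, y3)]"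
  define C where "C = (\<lambda>(b, c, d). convex hull {p, b, c, d})"
  have C_compact: "compact (C t)" for t
    unfolding C_def by (cases t) (auto intro: finite_imp_compact_convex_hull)
  have T_L: "?T = (\<lambda>(b, c, d). {b, c, d}) ` set L"
    unfolding prism_triangles_def apex_triangles_def L_def by (simp add: insert_commute[of y2 y1])
  have "P \<subseteq> (\<Union>t\<in>set L. C t)"
  proof
    fix z assume "z \<in> P"
    then obtain S where S: "S \<in> ?T" "z \<in> convex hull (insert p (convex hull S))"
      using polytope_subset_cones_over_facets[OF P p] unfolding F by blast
    then obtain b c d where t: "(b, c, d) \<in> set L" "S = {b, c, d}" unfolding T_L by auto
    have "convex hull (insert p (convex hull S)) = convex hull (insert p S)"
      by (metis hull_insert)
    then have "z \<in> C (b, c, d)" using S t by (simp add: C_def)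
    then show "z \<in> (\<Union>t\<in>set L. C t)" using t by blast
  qed
  then have "emeasure lebesgue P \<le> emeasure lebesgue (\<Union>t\<in>set L. C t)"
    by (intro emeasure_mono sets.finite_UN) (auto intro: lmeasurable_compact C_compact fmeasurableD)
  also have "\<dots> \<le> (\<Sum>t\<leftarrow>L. emeasure lebesgue (C t))"
    by (rule emeasure_UN_list_le) (auto intro: lmeasurable_compact C_compact fmeasurableD)
  also have "\<dots> = ennreal (\<Sum>t\<leftarrow>L. measure lebesgue (C t))"
  proof -
    have "emeasure lebesgue (C t) = ennreal (measure lebesgue (C t))" for t
      using lmeasurable_compact[OF C_compact] by (simp add: emeasure_eq_measure2)
    moreover have "(\<Sum>t\<leftarrow>K. ennreal (measure lebesgue (C t))) = ennreal (\<Sum>t\<leftarrow>K. measure lebesgue (C t))" for K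
    proof (induction K)
      case (Cons a K)
      have "0 \<le> (\<Sum>t\<leftarrow>K. measure lebesgue (C t))" by (rule sum_list_nonneg) auto
      then show ?case using Cons by (simp add: ennreal_plus)
    qed simp
    ultimately show ?thesis by simp
  qed
  finally have "measure lebesgue P \<le> enn2real (ennreal (\<Sum>t\<leftarrow>L. measure lebesgue (C t)))"
    unfolding measure_def by (rule enn2real_mono) simp
  also have "\<dots> = (\<Sum>t\<leftarrow>L. measure lebesgue (C t))"
    by (intro enn2real_ennreal sum_list_nonneg) auto
  also have "\<dots> = signed_volume p x1 x2 x3 + signed_volume p y2 y1 y3
   + (signed_volume p a1 x1 y1 + signed_volume p a1 y1 y2 + signed_volume p a1 y2 x2 + signed_volume p a1 x2 x1)
   + (signed_volume p a2 x2 y2 + signed_volume p a2 y2 y3 + signed_volume p a2 y3 x3 + signed_volume p a2 x3 x2)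
   + (signed_volume p a3 x3 y3 + signed_volume p a3 y3 y1 + signed_volume p a3 y1 x1 + signed_volume p a3 x1 x3)"
    using pos b1 b2 b3 yy unfolding L_def C_def by (simp add: measure_tetrahedron)
  finally show ?thesis unfolding sum_signed_volumes[of p, symmetric] by simp
qed

section \<open>The case of equality\<close>

text \<open>Replacing all \<open>v\<close>'s by their negatives exchanges the two determinants, so
  only the terms of odd degree in the \<open>v\<close>'s survive in their difference.\<close>

lemma ttp_functional_midpoints:
  "ttp_functional (u1 + v1) (u2 + v2) (u3 + v3) (u1 - v1) (u2 - v2) (u3 - v3) a1 a2 a3 =
    2 * (u1 \<bullet> (u2 \<times> v3) + u2 \<bullet> (u3 \<times> v1) + u3 \<bullet> (u1 \<times> v2) + v1 \<bullet> (v2 \<times> v3))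
    + 2 * (a1 \<bullet> ((u2 - u1) \<times> (v1 + v2)) + a2 \<bullet> ((u3 - u2) \<times> (v2 + v3)) + a3 \<bullet> ((u1 - u3) \<times> (v3 + v1)))"
proof -
  have det: "(u1 + v1) \<bullet> ((u2 + v2) \<times> (u3 + v3)) - (u1 - v1) \<bullet> ((u2 - v2) \<times> (u3 - v3))
     = 2 * (u1 \<bullet> (u2 \<times> v3) + u2 \<bullet> (u3 \<times> v1) + u3 \<bullet> (u1 \<times> v2) + v1 \<bullet> (v2 \<times> v3))"
    by (simp add: cross3_simps)
  have quad: "((u + v) - (u' - v')) \<times> ((u - v) - (u' + v')) = 2 *\<^sub>R ((u' - u) \<times> (v + v'))" for u v u' v' :: "real^3"
    by (simp add: cross3_simps forall_3)
  show ?thesis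
    unfolding ttp_functional_def det quad by simp
qed

lemma unit_vectors_eq:
  fixes a b :: "'a::real_inner"
  assumes "norm a = 1" "norm b = 1" "a \<bullet> b = 1"
  shows "a = b"
proof -
  have "a \<bullet> a = 1" "b \<bullet> b = 1" using assms by (simp_all add: norm_eq_1)
  then have "(a - b) \<bullet> (a - b) = 0"
    using assms(3) by (simp add: inner_diff_left inner_diff_right inner_commute)
  then show ?thesis by simp
qed

text \<open>\<open>\<delta>\<close> is the orientation of the triad. It is left open here because,
  in the equality case, only the value of the functional decides it.\<close>

lemma orthonormal_triad_cross:
  fixes e1 e2 e3 :: "real^3"
  assumes "e1 \<bullet> e1 = 1" "e2 \<bullet> e2 = 1" "e3 \<bullet> e3 = 1" "e1 \<bullet> e2 = 0" "e1 \<bullet> e3 = 0" "e2 \<bullet> e3 = 0"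
  obtains \<delta> where "\<delta> = 1 \<or> \<delta> = - 1" "e2 \<times> e3 = \<delta> *\<^sub>R e1" "e1 \<times> e3 = - (\<delta> *\<^sub>R e2)"
proof -
  have triple: "a \<times> (b \<times> c) = (a \<bullet> c) *\<^sub>R b - (a \<bullet> b) *\<^sub>R c" for a b c :: "real^3"
    by (simp add: cross3_simps forall_3)
  define \<delta> where "\<delta> = e1 \<bullet> (e2 \<times> e3)"
  have "e1 \<times> (e2 \<times> e3) = 0" unfolding triple using assms by simp
  then have "e1 \<times> (e1 \<times> (e2 \<times> e3)) = 0" by simp
  then have c: "e2 \<times> e3 = \<delta> *\<^sub>R e1"
    unfolding triple[of e1 e1] \<delta>_def using assms by simp
  have "(norm (e2 \<times> e3))\<^sup>2 = 1"
    using norm_cross_dot[of e2 e3] assms by (simp add: norm_eq_sqrt_inner)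
  then have "\<delta>\<^sup>2 = 1" unfolding c using assms by (simp add: norm_eq_sqrt_inner)
  then have \<delta>: "\<delta> = 1 \<or> \<delta> = - 1" by (simp add: power2_eq_1_iff)
  have "e3 \<times> (e2 \<times> e3) = e2" unfolding triple using assms by (simp add: inner_commute)
  then have "\<delta> *\<^sub>R (e3 \<times> e1) = e2" unfolding c by (simp add: cross_mult_right)
  then have "\<delta> *\<^sub>R (\<delta> *\<^sub>R (e3 \<times> e1)) = \<delta> *\<^sub>R e2" by simp
  then have "e3 \<times> e1 = \<delta> *\<^sub>R e2" using \<open>\<delta>\<^sup>2 = 1\<close> by (simp add: power2_eq_square)
  then have "e1 \<times> e3 = - (\<delta> *\<^sub>R e2)" by (metis cross_skew)
  with \<delta> c show ?thesis by (rule that)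
qed

text \<open>The generating points are named separately so that rotations and symmetries of the prism
  can be checked on nine points.\<close>

definition optimal_vertices :: "(real^3) set" where
  "optimal_vertices =
     {vector [1, 0, 0],
      vector [- 1/2, sqrt 3 / 2, 0],
      vector [- 1/2, - sqrt 3 / 2, 0],
      vector [1/2 * r_star, sqrt 3 / 2 * r_star, h_star],
      vector [- r_star, 0, h_star],
      vector [1/2 * r_star, - sqrt 3 / 2 * r_star, h_star],
      vector [1/2 * r_star, sqrt 3 / 2 * r_star, - h_star],
      vector [- r_star, 0, - h_star],
      vector [1/2 * r_star, - sqrt 3 / 2 * r_star, - h_star]}"

lemma optimal_prism_eq: "optimal_prism = convex hull optimal_vertices"
  unfolding optimal_prism_def optimal_vertices_def ..

text \<open>The matrix with columns \<open>e1\<close>, \<open>e2\<close>, \<open>e3\<close> is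
  orthogonal, and \<open>e2 \<times> e3 = e1\<close> makes its determinant 1.\<close>

lemma rotation_onto_orthonormal_triad:
  fixes e1 e2 e3 :: "real^3"
  assumes "e1 \<bullet> e1 = 1" "e2 \<bullet> e2 = 1" "e3 \<bullet> e3 = 1" "e1 \<bullet> e2 = 0" "e1 \<bullet> e3 = 0" "e2 \<bullet> e3 = 0"
    and "e2 \<times> e3 = e1"
  obtains R :: "real^3^3" where "rotation_matrix R"
    "\<And>p q w. R *v vector [p, q, w] = p *\<^sub>R e1 + q *\<^sub>R e2 + w *\<^sub>R e3"
proof
  define M :: "real^3^3" where "M = vector [e1, e2, e3]"
  have "orthogonal_matrix M"
    unfolding orthogonal_matrix_orthonormal_rows orthogonal_def M_def forall_3 row_def
    using assms by (simp add: vector_3 norm_eq_1 inner_commute)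
  moreover have "det M = 1"
    unfolding M_def dot_cross_det[symmetric] using assms by simp
  ultimately show "rotation_matrix (transpose M)"
    unfolding rotation_matrix_def by (simp add: det_transpose)
  show "transpose M *v vector [p, q, w] = p *\<^sub>R e1 + q *\<^sub>R e2 + w *\<^sub>R e3" for p q w
    unfolding M_def by (simp add: vec_eq_iff matrix_vector_mult_def transpose_def sum_3 vector_3 mult.commute)
qed

text \<open>For fixed \<open>x\<close>'s and \<open>y\<close>'s the best apex is the unit vector
  along \<open>z1\<close>, \<open>z2\<close>, \<open>z3\<close> respectively, which gives twice
  \<open>midpoint_functional\<close>. Equality forces the \<open>u\<close>'s into an equilateral
  triangle orthogonal to the common \<open>v\<close>, and then the apices.\<close>

lemma ttp_functional_bound:
  assumes x: "norm x1 = 1" "norm x2 = 1" "norm x3 = 1" and y: "norm y1 = 1" "norm y2 = 1" "norm y3 = 1"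
    and a: "norm a1 = 1" "norm a2 = 1" "norm a3 = 1"
  shows "ttp_functional x1 x2 x3 y1 y2 y3 a1 a2 a3 \<le> 18 * h_star"
    and "ttp_functional x1 x2 x3 y1 y2 y3 a1 a2 a3 = 18 * h_star \<Longrightarrow>
      \<exists>R :: real^3^3. rotation_matrix R \<and> {x1, x2, x3, y1, y2, y3, a1, a2, a3} = (\<lambda>v. R *v v) ` optimal_vertices"
proof -
  define u1 u2 u3 v1 v2 v3 where uv:
    "u1 = (1/2) *\<^sub>R (x1 + y1)" "u2 = (1/2) *\<^sub>R (x2 + y2)" "u3 = (1/2) *\<^sub>R (x3 + y3)"
    "v1 = (1/2) *\<^sub>R (x1 - y1)" "v2 = (1/2) *\<^sub>R (x2 - y2)" "v3 = (1/2) *\<^sub>R (x3 - y3)"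
  have half: "p = (1/2) *\<^sub>R (p + q) + (1/2) *\<^sub>R (p - q)" "q = (1/2) *\<^sub>R (p + q) - (1/2) *\<^sub>R (p - q)" for p q :: "real^3"
    by (simp_all add: vec_eq_iff field_simps)
  have xy: "x1 = u1 + v1" "x2 = u2 + v2" "x3 = u3 + v3" "y1 = u1 - v1" "y2 = u2 - v2" "y3 = u3 - v3"
    unfolding uv by (rule half)+
  have sphere: "u \<bullet> u + v \<bullet> v = 1 \<and> u \<bullet> v = 0" if "norm (u + v) = 1" "norm (u - v) = 1" for u v :: "real^3"
  proof -
    have "(u + v) \<bullet> (u + v) = 1" "(u - v) \<bullet> (u - v) = 1" using that by (simp_all add: norm_eq_1)
    then have "u \<bullet> u + v \<bullet> v + 2 * (u \<bullet> v) = 1" "u \<bullet> u + v \<bullet> v - 2 * (u \<bullet> v) = 1"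
      by (simp_all add: inner_add_left inner_add_right inner_diff_left inner_diff_right inner_commute)
    then show ?thesis by simp
  qed
  have s1: "u1 \<bullet> u1 + v1 \<bullet> v1 = 1 \<and> u1 \<bullet> v1 = 0" and s2: "u2 \<bullet> u2 + v2 \<bullet> v2 = 1 \<and> u2 \<bullet> v2 = 0"
    and s3: "u3 \<bullet> u3 + v3 \<bullet> v3 = 1 \<and> u3 \<bullet> v3 = 0"
    using x y unfolding xy by (simp_all add: sphere)
  have norms: "(norm u1)\<^sup>2 + (norm u2)\<^sup>2 + (norm u3)\<^sup>2 + (norm v1)\<^sup>2 + (norm v2)\<^sup>2 + (norm v3)\<^sup>2 = 3"
    unfolding power2_norm_eq_inner using s1 s2 s3 by simp
  define z1 z2 z3 where z: "z1 = (u2 - u1) \<times> (v1 + v2)" "z2 = (u3 - u2) \<times> (v2 + v3)" "z3 = (u1 - u3) \<times> (v3 + v1)"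
  have az: "a1 \<bullet> z1 \<le> norm z1" "a2 \<bullet> z2 \<le> norm z2" "a3 \<bullet> z3 \<le> norm z3"
    using norm_cauchy_schwarz[of a1 z1] norm_cauchy_schwarz[of a2 z2] norm_cauchy_schwarz[of a3 z3] a by simp_all
  define mid where "mid = midpoint_functional u1 u2 u3 v1 v2 v3"
  \<comment> \<open>The losses of the three apices against their optimal position; all of them
    vanish in the equality case.\<close>
  define g1 g2 g3 where g: "g1 = norm z1 - a1 \<bullet> z1" "g2 = norm z2 - a2 \<bullet> z2" "g3 = norm z3 - a3 \<bullet> z3"
  have g0: "g1 \<ge> 0" "g2 \<ge> 0" "g3 \<ge> 0" using az unfolding g by simp_all
  have eq: "ttp_functional x1 x2 x3 y1 y2 y3 a1 a2 a3 = 2 * mid - 2 * g1 - 2 * g2 - 2 * g3"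
    unfolding xy ttp_functional_midpoints mid_def midpoint_functional_def z[symmetric] g by simp
  have mid_le: "mid \<le> 9 * h_star" unfolding mid_def by (rule midpoint_functional_bound(1)[OF norms])
  then show "ttp_functional x1 x2 x3 y1 y2 y3 a1 a2 a3 \<le> 18 * h_star"
    unfolding eq using g0 by linarith
  assume "ttp_functional x1 x2 x3 y1 y2 y3 a1 a2 a3 = 18 * h_star"
  then have mid: "mid = 9 * h_star" and "g1 = 0" "g2 = 0" "g3 = 0"
    unfolding eq using g0 mid_le by linarith+
  then have az_eq: "a1 \<bullet> z1 = norm z1" "a2 \<bullet> z2 = norm z2" "a3 \<bullet> z3 = norm z3"
    unfolding g by simp_all
  define r h s where rhs: "r = r_star" "h = h_star" "s = sqrt 3"
  have r0: "r > 0" and h0: "h > 0" and s0: "s > 0" and ss: "s * s = 3" and rs: "r = s - 1"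
    and r2: "r * r = 1 - h * h"
    using r_star_pos h_star_pos r_star_eq(2) r_star_sq by (simp_all add: rhs power2_eq_square)
  define v where "v = v3"
  have conf: "u1 + u2 + u3 = 0" "v1 = v" "v2 = v" "v3 = v" "norm v = h"
    using midpoint_functional_bound(2)[OF norms] mid unfolding mid_def v_def rhs by auto
  have vv: "v \<bullet> v = h * h" using conf(5) by (metis power2_eq_square power2_norm_eq_inner)
  have uu: "u1 \<bullet> u1 = r * r" "u2 \<bullet> u2 = r * r" "u3 \<bullet> u3 = r * r" and uv0: "u1 \<bullet> v = 0" "u2 \<bullet> v = 0" "u3 \<bullet> v = 0"
    using s1 s2 s3 unfolding conf vv r2 by simp_all
  have u13: "u1 + u3 = - u2" using conf(1) by (simp add: eq_neg_iff_add_eq_0 add_ac)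
  \<comment> \<open>The frame imitates the optimal prism, where the second midpoint is
    \<open>(- r, 0, 0)\<close> and the first minus the third is
    \<open>(0, s * r, 0)\<close>.\<close>
  define e1 e2 e3 where e: "e1 = (- 1 / r) *\<^sub>R u2" "e2 = (1 / (s * r)) *\<^sub>R (u1 - u3)" "e3 = (1 / h) *\<^sub>R v"
  \<comment> \<open>Three vectors of equal length \<open>r\<close> with sum 0 form an equilateral
    triangle of side \<open>s * r\<close>.\<close>
  have d13: "(u1 - u3) \<bullet> (u1 - u3) = 3 * (r * r)" and o13: "u2 \<bullet> (u1 - u3) = 0"
  proof -
    have "(u1 + u3) \<bullet> (u1 + u3) = r * r" unfolding u13 by (simp add: uu)
    then show "(u1 - u3) \<bullet> (u1 - u3) = 3 * (r * r)"
      using uu by (simp add: inner_add_left inner_add_right inner_diff_left inner_diff_right inner_commute)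
    have "(u1 + u3) \<bullet> (u1 - u3) = 0"
      using uu by (simp add: inner_add_left inner_add_right inner_diff_left inner_diff_right inner_commute)
    then show "u2 \<bullet> (u1 - u3) = 0" unfolding u13 by simp
  qed
  have on: "e1 \<bullet> e1 = 1" "e2 \<bullet> e2 = 1" "e3 \<bullet> e3 = 1" "e1 \<bullet> e2 = 0" "e1 \<bullet> e3 = 0" "e2 \<bullet> e3 = 0"
  proof -
    have "(u1 - u3) \<bullet> v = 0" using uv0 by (simp add: inner_diff_left)
    then show "e1 \<bullet> e1 = 1" "e2 \<bullet> e2 = 1" "e3 \<bullet> e3 = 1" "e1 \<bullet> e2 = 0" "e1 \<bullet> e3 = 0" "e2 \<bullet> e3 = 0"
      unfolding e inner_scaleR_left inner_scaleR_right uu vv d13 o13 uv0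
      using r0 s0 h0 ss by (simp_all add: field_simps)
  qed
  obtain \<delta> where \<delta>: "\<delta> = 1 \<or> \<delta> = - 1" and c: "e2 \<times> e3 = \<delta> *\<^sub>R e1" "e1 \<times> e3 = - (\<delta> *\<^sub>R e2)"
    by (rule orthonormal_triad_cross[OF on])
  have on': "e2 \<bullet> e1 = 0" "e3 \<bullet> e1 = 0" "e3 \<bullet> e2 = 0" using on by (simp_all add: inner_commute)
  have v_e: "v = h *\<^sub>R e3" and u2_e: "u2 = (- r) *\<^sub>R e1" unfolding e using h0 r0 by simp_all
  have diff: "u1 - u3 = (s * r) *\<^sub>R e2" unfolding e using s0 r0 by simp
  have u1_e: "u1 = (r / 2) *\<^sub>R e1 + (s * r / 2) *\<^sub>R e2"
    and u3_e: "u3 = (r / 2) *\<^sub>R e1 - (s * r / 2) *\<^sub>R e2"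
  proof -
    have sum: "u1 + u3 = r *\<^sub>R e1" unfolding u13 u2_e by simp
    have "u1 = (1/2) *\<^sub>R (u1 + u3) + (1/2) *\<^sub>R (u1 - u3)" "u3 = (1/2) *\<^sub>R (u1 + u3) - (1/2) *\<^sub>R (u1 - u3)"
      by (rule half)+
    then show "u1 = (r / 2) *\<^sub>R e1 + (s * r / 2) *\<^sub>R e2" "u3 = (r / 2) *\<^sub>R e1 - (s * r / 2) *\<^sub>R e2"
      unfolding sum diff by simp_all
  qed
  define b1 b2 where b: "b1 = (- 1/2) *\<^sub>R e1 + (s / 2) *\<^sub>R e2" "b2 = (- 1/2) *\<^sub>R e1 - (s / 2) *\<^sub>R e2"
  have nb: "norm b1 = 1" "norm b2 = 1" "norm e1 = 1"
    unfolding norm_eq_1 b using on on' ss by (simp_all add: inner_add_left inner_add_right inner_diff_left inner_diff_right)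
  have scale: "3 * r = s * (s * r)" using ss by simp
  have vec: "(p *\<^sub>R e1 + q *\<^sub>R e2) \<times> (w *\<^sub>R e3) = (\<delta> * w) *\<^sub>R (q *\<^sub>R e1 - p *\<^sub>R e2)" for p q w
    by (simp add: cross_add_left cross_mult_left cross_mult_right c algebra_simps)
  have d1: "u2 - u1 = (- (3 * r) / 2) *\<^sub>R e1 + (- s * r / 2) *\<^sub>R e2" and d2: "u3 - u2 = (3 * r / 2) *\<^sub>R e1 + (- s * r / 2) *\<^sub>R e2"
    and d3: "u1 - u3 = 0 *\<^sub>R e1 + (s * r) *\<^sub>R e2"
    unfolding u1_e u2_e u3_e by (simp_all add: vec_eq_iff field_simps)
  have vv2: "v + v = (2 * h) *\<^sub>R e3" unfolding v_e by (simp add: vec_eq_iff)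
  have zb: "z1 = (\<delta> * (2 * h * s * r)) *\<^sub>R b1" "z2 = (\<delta> * (2 * h * s * r)) *\<^sub>R b2" "z3 = (\<delta> * (2 * h * s * r)) *\<^sub>R e1"
    unfolding z conf d1 d2 d3 vv2 vec b scale by (simp_all add: vec_eq_iff algebra_simps)
  have nz: "norm z1 = 2 * h * s * r" "norm z2 = 2 * h * s * r" "norm z3 = 2 * h * s * r"
    unfolding zb norm_scaleR nb using \<delta> h0 s0 r0 by auto
  have t: "u1 \<bullet> (u2 \<times> v) = \<delta> * (h * s * r * r / 2)" "u2 \<bullet> (u3 \<times> v) = \<delta> * (h * s * r * r / 2)"
    "u3 \<bullet> (u1 \<times> v) = \<delta> * (h * s * r * r / 2)"
  proof -
    have u2': "u2 = (- r) *\<^sub>R e1 + 0 *\<^sub>R e2" unfolding u2_e by simp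
    have u3': "u3 = (r / 2) *\<^sub>R e1 + (- s * r / 2) *\<^sub>R e2" unfolding u3_e by simp
    show "u1 \<bullet> (u2 \<times> v) = \<delta> * (h * s * r * r / 2)" "u2 \<bullet> (u3 \<times> v) = \<delta> * (h * s * r * r / 2)"
      "u3 \<bullet> (u1 \<times> v) = \<delta> * (h * s * r * r / 2)"
      unfolding v_e u1_e u2' u3' vec using on on'
      by (simp_all add: inner_add_left inner_diff_left inner_diff_right algebra_simps)
  qed
  \<comment> \<open>The triple products carry the sign \<open>\<delta>\<close> and the norms do not.
    The value \<open>9 * h\<close> is attained only for \<open>\<delta> = 1\<close>, so a
    mirror-image labelling is excluded.\<close>
  have "mid = 3 * (\<delta> * (h * s * r * r / 2)) + 3 * (2 * h * s * r)"
    unfolding mid_def midpoint_functional_def z[symmetric] unfolding nz unfolding conf t by simp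
  moreover have "3 * (h * s * r * r / 2) + 3 * (2 * h * s * r) = 9 * h"
  proof -
    have "s * r * r = 4 * s - 6" "s * r = 3 - s" unfolding rs using ss by (simp_all add: algebra_simps)
    then have "3 * (s * r * r / 2) + 3 * (2 * (s * r)) = 3 * ((4 * s - 6) / 2) + 3 * (2 * (3 - s))"
      by (simp only:)
    also have "\<dots> = 9" by (simp add: field_simps)
    finally have "3 * (s * r * r / 2) + 3 * (2 * (s * r)) = 9" .
    then have "h * (3 * (s * r * r / 2) + 3 * (2 * (s * r))) = h * 9" by simp
    then show ?thesis by (simp add: algebra_simps)
  qed
  ultimately have "\<delta> * (h * s * r * r / 2) = h * s * r * r / 2"
    using mid unfolding rhs by linarith
  then have "\<delta> = 1" using h0 s0 r0 by simp
  have ab: "a1 = b1" "a2 = b2" "a3 = e1"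
    using az_eq h0 s0 r0 unfolding nz unfolding zb \<open>\<delta> = 1\<close> by (auto intro!: unit_vectors_eq a nb)
  obtain R :: "real^3^3" where R: "rotation_matrix R"
    "\<And>p q w. R *v vector [p, q, w] = p *\<^sub>R e1 + q *\<^sub>R e2 + w *\<^sub>R e3"
    using rotation_onto_orthonormal_triad[OF on] c(1) \<open>\<delta> = 1\<close> by auto
  \<comment> \<open>The apices appear cyclically shifted: the point \<open>(1, 0, 0)\<close> goes to
    \<open>e1\<close>, which is \<open>a3\<close>, the apex between the indices 3 and 1.\<close>
  have "(\<lambda>v. R *v v) ` optimal_vertices = {a3, a1, a2, x1, x2, x3, y1, y2, y3}"
    unfolding optimal_vertices_def image_insert image_empty R(2) rhs[symmetric] xy conf(2-4) ab b u1_e u2_e u3_e v_e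
    by (simp add: mult.commute)
  also have "\<dots> = {x1, x2, x3, y1, y2, y3, a1, a2, a3}"
    by (simp only: insert_commute)
  finally show "\<exists>R :: real^3^3. rotation_matrix R \<and> {x1, x2, x3, y1, y2, y3, a1, a2, a3} = (\<lambda>v. R *v v) ` optimal_vertices"
    using R(1) by metis
qed

section \<open>The volume of the optimal prism\<close>

text \<open>Only points on finitely many hyperplanes are removed, a null set. This turns pieces that
  share boundary walls into disjoint ones of the same measure.\<close>

lemma measure_Int_open_halfspaces:
  fixes S :: "'a::euclidean_space set"
  assumes "finite N" "0 \<notin> N" and S: "S \<in> lmeasurable" and nonneg: "\<And>x n. x \<in> S \<Longrightarrow> n \<in> N \<Longrightarrow> 0 \<le> n \<bullet> x"
  shows "S \<inter> {x. \<forall>n\<in>N. 0 < n \<bullet> x} \<in> lmeasurable"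
    and "measure lebesgue (S \<inter> {x. \<forall>n\<in>N. 0 < n \<bullet> x}) = measure lebesgue S"
proof -
  let ?T = "S \<inter> {x. \<forall>n\<in>N. 0 < n \<bullet> x}"
  have "negligible (\<Union>n\<in>N. {x. n \<bullet> x = 0})"
    using assms(1,2) by (intro negligible_Union) (auto intro: negligible_hyperplane)
  moreover have "sym_diff ?T S \<subseteq> (\<Union>n\<in>N. {x. n \<bullet> x = 0})"
    using nonneg by (force simp: order_less_le)
  ultimately have neg: "negligible (sym_diff ?T S)" by (rule negligible_subset)
  then show "?T \<in> lmeasurable" "measure lebesgue ?T = measure lebesgue S"
    using lmeasurable_negligible_symdiff[OF S, of ?T] measure_negligible_symdiff[OF S, of ?T]
    by (simp_all add: Un_commute)
qed

lemma measure_Un_orthogonal_image: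
  fixes g :: "real^3 \<Rightarrow> real^3"
  assumes "orthogonal_transformation g" "B \<in> lmeasurable" "g ` B \<inter> B = {}"
  shows "B \<union> g ` B \<in> lmeasurable" "measure lebesgue (B \<union> g ` B) = 2 * measure lebesgue B"
proof -
  have gB: "g ` B \<in> lmeasurable" "measure lebesgue (g ` B) = measure lebesgue B"
    using assms by (simp_all add: measurable_orthogonal_image measure_orthogonal_image)
  then show "B \<union> g ` B \<in> lmeasurable" using assms by blast
  show "measure lebesgue (B \<union> g ` B) = 2 * measure lebesgue B"
    using assms gB by (subst measure_Un3) (auto simp: Int_commute)
qed

section \<open>Symmetries of the optimal prism and a fundamental chamber\<close>

definition rot120 :: "real^3 \<Rightarrow> real^3" where
  "rot120 p = vector [- (1/2) * p $ 1 - sqrt 3 / 2 * p $ 2, sqrt 3 / 2 * p $ 1 - 1/2 * p $ 2, p $ 3]"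

definition rot240 :: "real^3 \<Rightarrow> real^3" where
  "rot240 p = vector [- (1/2) * p $ 1 + sqrt 3 / 2 * p $ 2, - (sqrt 3 / 2) * p $ 1 - 1/2 * p $ 2, p $ 3]"

definition flip_y :: "real^3 \<Rightarrow> real^3" where
  "flip_y p = vector [p $ 1, - p $ 2, p $ 3]"

definition flip_z :: "real^3 \<Rightarrow> real^3" where
  "flip_z p = vector [p $ 1, p $ 2, - p $ 3]"

lemma orthogonal_symmetries:
  "orthogonal_transformation rot120" "orthogonal_transformation rot240"
  "orthogonal_transformation flip_y" "orthogonal_transformation flip_z"
proof -
  have s: "sqrt 3 * (sqrt 3 * x) = 3 * x" for x :: real
    by (simp flip: mult.assoc)
  show "orthogonal_transformation rot120" "orthogonal_transformation rot240"
    "orthogonal_transformation flip_y" "orthogonal_transformation flip_z"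
    unfolding orthogonal_transformation_def rot120_def rot240_def flip_y_def flip_z_def
    by (auto intro!: linearI simp: inner_vec_def sum_3 vec_eq_iff forall_3 vector_3 field_simps s)
qed

lemma symmetries_optimal_vertices:
  "rot120 ` optimal_vertices \<subseteq> optimal_vertices" "rot240 ` optimal_vertices \<subseteq> optimal_vertices"
  "flip_y ` optimal_vertices \<subseteq> optimal_vertices" "flip_z ` optimal_vertices \<subseteq> optimal_vertices"
proof -
  have s: "sqrt 3 * (sqrt 3 * x) = 3 * x" for x :: real
    by (simp flip: mult.assoc)
  let ?r = r_star and ?s = "sqrt 3 :: real"
  have "rot120 (vector [1, 0, 0]) = vector [- 1/2, ?s / 2, 0]"
    "rot120 (vector [- 1/2, ?s / 2, 0]) = vector [- 1/2, - ?s / 2, 0]"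
    "rot120 (vector [- 1/2, - ?s / 2, 0]) = vector [1, 0, 0]"
    "rot120 (vector [1/2 * ?r, ?s / 2 * ?r, w]) = vector [- ?r, 0, w]"
    "rot120 (vector [- ?r, 0, w]) = vector [1/2 * ?r, - ?s / 2 * ?r, w]"
    "rot120 (vector [1/2 * ?r, - ?s / 2 * ?r, w]) = vector [1/2 * ?r, ?s / 2 * ?r, w]" for w
    unfolding rot120_def by (simp_all add: vec_eq_iff forall_3 vector_3 field_simps s)
  then show "rot120 ` optimal_vertices \<subseteq> optimal_vertices"
    unfolding optimal_vertices_def image_insert image_empty by (simp only:) blast
  have "rot240 (vector [1, 0, 0]) = vector [- 1/2, - ?s / 2, 0]"
    "rot240 (vector [- 1/2, ?s / 2, 0]) = vector [1, 0, 0]"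
    "rot240 (vector [- 1/2, - ?s / 2, 0]) = vector [- 1/2, ?s / 2, 0]"
    "rot240 (vector [1/2 * ?r, ?s / 2 * ?r, w]) = vector [1/2 * ?r, - ?s / 2 * ?r, w]"
    "rot240 (vector [- ?r, 0, w]) = vector [1/2 * ?r, ?s / 2 * ?r, w]"
    "rot240 (vector [1/2 * ?r, - ?s / 2 * ?r, w]) = vector [- ?r, 0, w]" for w
    unfolding rot240_def by (simp_all add: vec_eq_iff forall_3 vector_3 field_simps s)
  then show "rot240 ` optimal_vertices \<subseteq> optimal_vertices"
    unfolding optimal_vertices_def image_insert image_empty by (simp only:) blast
  have "flip_y (vector [1, 0, 0]) = vector [1, 0, 0]"
    "flip_y (vector [- 1/2, ?s / 2, 0]) = vector [- 1/2, - ?s / 2, 0]"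
    "flip_y (vector [- 1/2, - ?s / 2, 0]) = vector [- 1/2, ?s / 2, 0]"
    "flip_y (vector [1/2 * ?r, ?s / 2 * ?r, w]) = vector [1/2 * ?r, - ?s / 2 * ?r, w]"
    "flip_y (vector [- ?r, 0, w]) = vector [- ?r, 0, w]"
    "flip_y (vector [1/2 * ?r, - ?s / 2 * ?r, w]) = vector [1/2 * ?r, ?s / 2 * ?r, w]" for w
    unfolding flip_y_def by (simp_all add: vec_eq_iff forall_3 vector_3)
  then show "flip_y ` optimal_vertices \<subseteq> optimal_vertices"
    unfolding optimal_vertices_def image_insert image_empty by (simp only:) blast
  have "flip_z (vector [p, q, w]) = vector [p, q, - w]" for p q w
    unfolding flip_z_def by (simp add: vec_eq_iff forall_3 vector_3)
  then show "flip_z ` optimal_vertices \<subseteq> optimal_vertices"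
    unfolding optimal_vertices_def image_insert image_empty by (simp only: minus_minus minus_zero) blast
qed

lemma image_optimal_prism_subset:
  assumes "orthogonal_transformation g" "g ` optimal_vertices \<subseteq> optimal_vertices" "B \<subseteq> optimal_prism"
  shows "g ` B \<subseteq> optimal_prism"
proof -
  have "g ` optimal_prism = convex hull (g ` optimal_vertices)"
    unfolding optimal_prism_eq
    by (rule convex_hull_linear_image) (use assms in \<open>simp add: orthogonal_transformation_def\<close>)
  also have "\<dots> \<subseteq> optimal_prism" unfolding optimal_prism_eq by (rule hull_mono[OF assms(2)])
  finally show ?thesis using assms(3) by blast
qed

lemma optimal_prism_lmeasurable: "optimal_prism \<in> lmeasurable"
  unfolding optimal_prism_eq optimal_vertices_def
  by (intro lmeasurable_compact finite_imp_compact_convex_hull) simp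

text \<open>The 12 images of the chamber under the symmetry group of the prism are disjoint.\<close>

lemma measure_fundamental_chamber_le:
  assumes B: "B \<in> lmeasurable" "B \<subseteq> optimal_prism"
    and chamber: "\<And>p. p \<in> B \<Longrightarrow> 0 < p $ 2 \<and> 0 < p $ 3 \<and> p $ 2 < sqrt 3 * p $ 1"
  shows "12 * measure lebesgue B \<le> measure lebesgue optimal_prism"
proof -
  define B2 where "B2 = B \<union> flip_z ` B"
  have "flip_z p \<notin> B" if "p \<in> B" for p
    using chamber[OF that] chamber[of "flip_z p"] by (auto simp: flip_z_def vector_3)
  then have "flip_z ` B \<inter> B = {}" by blast
  note m2 = measure_Un_orthogonal_image[OF orthogonal_symmetries(4) B(1) this, folded B2_def]
  have B2: "B2 \<subseteq> optimal_prism"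
    unfolding B2_def using image_optimal_prism_subset[OF orthogonal_symmetries(4) symmetries_optimal_vertices(4) B(2)] B(2) by blast
  have c2: "0 < p $ 2 \<and> p $ 2 < sqrt 3 * p $ 1" if "p \<in> B2" for p
    using that chamber unfolding B2_def by (auto simp: flip_z_def)
  define B4 where "B4 = B2 \<union> flip_y ` B2"
  have "flip_y p \<notin> B2" if "p \<in> B2" for p
    using c2[OF that] c2[of "flip_y p"] by (auto simp: flip_y_def vector_3)
  then have "flip_y ` B2 \<inter> B2 = {}" by blast
  note m4 = measure_Un_orthogonal_image[OF orthogonal_symmetries(3) m2(1) this, folded B4_def]
  have B4: "B4 \<subseteq> optimal_prism"
    unfolding B4_def using image_optimal_prism_subset[OF orthogonal_symmetries(3) symmetries_optimal_vertices(3) B2] B2 by blast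
  \<comment> \<open>\<open>B4\<close> lies in an open sector of opening 120 degrees around the third
    axis, which is disjoint from its rotations by 120 and 240 degrees.\<close>
  have c4: "\<bar>p $ 2\<bar> < sqrt 3 * p $ 1" if "p \<in> B4" for p
    using that c2 unfolding B4_def by (fastforce simp: flip_y_def)
  have s: "sqrt 3 * (sqrt 3 * x) = 3 * x" for x :: real
    by (simp flip: mult.assoc)
  have disj: "rot120 ` B4 \<inter> B4 = {}" "rot240 ` B4 \<inter> B4 = {}" "rot120 ` B4 \<inter> rot240 ` B4 = {}"
  proof -
    have no120: "rot120 p \<notin> B4" if "p \<in> B4" for p
    proof
      assume "rot120 p \<in> B4"
      from c4[OF this] have "\<bar>rot120 p $ 2\<bar> < sqrt 3 * rot120 p $ 1" .
      moreover have "rot120 p $ 2 = (sqrt 3 * p $ 1 - p $ 2) / 2"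
        "sqrt 3 * rot120 p $ 1 = (- (sqrt 3 * p $ 1) - 3 * p $ 2) / 2"
        unfolding rot120_def by (simp_all add: vector_3 field_simps s)
      ultimately show False using c4[OF that] by (simp only:) argo
    qed
    have no240: "rot240 p \<notin> B4" if "p \<in> B4" for p
    proof
      assume "rot240 p \<in> B4"
      from c4[OF this] have "\<bar>rot240 p $ 2\<bar> < sqrt 3 * rot240 p $ 1" .
      moreover have "rot240 p $ 2 = (- (sqrt 3 * p $ 1) - p $ 2) / 2"
        "sqrt 3 * rot240 p $ 1 = (3 * p $ 2 - sqrt 3 * p $ 1) / 2"
        unfolding rot240_def by (simp_all add: vector_3 field_simps s)
      ultimately show False using c4[OF that] by (simp only:) argo
    qed
    show "rot120 ` B4 \<inter> B4 = {}" "rot240 ` B4 \<inter> B4 = {}" using no120 no240 by blast+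
    \<comment> \<open>Rotating both sides by another 240 degrees reduces the third disjointness to
      \<open>no120\<close>.\<close>
    have "p = rot120 q" if "rot120 p = rot240 q" for p q
    proof -
      have "rot240 (rot120 p) = p" "rot240 (rot240 q) = rot120 q"
        unfolding rot120_def rot240_def by (simp_all add: vec_eq_iff forall_3 vector_3 field_simps s)
      then show ?thesis using that by metis
    qed
    then show "rot120 ` B4 \<inter> rot240 ` B4 = {}" using no120 by blast
  qed
  have im: "rot120 ` B4 \<in> lmeasurable" "measure lebesgue (rot120 ` B4) = measure lebesgue B4"
    "rot240 ` B4 \<in> lmeasurable" "measure lebesgue (rot240 ` B4) = measure lebesgue B4"
    using m4(1) orthogonal_symmetries by (simp_all add: measurable_orthogonal_image measure_orthogonal_image)
  have "measure lebesgue (B4 \<union> rot120 ` B4 \<union> rot240 ` B4)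
      = measure lebesgue B4 + measure lebesgue (rot120 ` B4) + measure lebesgue (rot240 ` B4)"
    using disj by (intro measure_Un3_negligible m4(1) im) (simp_all add: Int_commute)
  also have "\<dots> = 12 * measure lebesgue B" unfolding im m4(2) m2(2) by simp
  finally have total: "measure lebesgue (B4 \<union> rot120 ` B4 \<union> rot240 ` B4) = 12 * measure lebesgue B" .
  have "measure lebesgue (B4 \<union> rot120 ` B4 \<union> rot240 ` B4) \<le> measure lebesgue optimal_prism"
  proof (rule measure_mono_fmeasurable)
    show "B4 \<union> rot120 ` B4 \<union> rot240 ` B4 \<subseteq> optimal_prism"
      using B4 image_optimal_prism_subset[OF orthogonal_symmetries(1) symmetries_optimal_vertices(1) B4]
        image_optimal_prism_subset[OF orthogonal_symmetries(2) symmetries_optimal_vertices(2) B4] by blast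
    show "B4 \<union> rot120 ` B4 \<union> rot240 ` B4 \<in> sets lebesgue"
      using m4(1) im by (simp add: fmeasurableD)
  qed (rule optimal_prism_lmeasurable)
  then show ?thesis unfolding total .
qed

section \<open>Tetrahedra in the chamber and the volume from below\<close>

lemma tetrahedron_Int_open_halfspaces:
  fixes p q w :: "real^3"
  assumes "finite N" "0 \<notin> N" "\<And>n x. n \<in> N \<Longrightarrow> x \<in> {p, q, w} \<Longrightarrow> 0 \<le> n \<bullet> x"
  shows "convex hull {0, p, q, w} \<inter> {x. \<forall>n\<in>N. 0 < n \<bullet> x} \<in> lmeasurable"
    and "measure lebesgue (convex hull {0, p, q, w} \<inter> {x. \<forall>n\<in>N. 0 < n \<bullet> x}) = \<bar>p \<bullet> (q \<times> w)\<bar> / 6"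
proof -
  have "0 \<le> n \<bullet> x" if "n \<in> N" "x \<in> convex hull {0, p, q, w}" for n x
  proof -
    have "convex hull {0, p, q, w} \<subseteq> {x. n \<bullet> x \<ge> 0}"
      using assms(3)[OF that(1)] by (intro hull_minimal convex_halfspace_ge) auto
    then show ?thesis using that(2) by auto
  qed
  moreover have "convex hull {0, p, q, w} \<in> lmeasurable"
    by (intro lmeasurable_compact finite_imp_compact_convex_hull) simp
  ultimately show "convex hull {0, p, q, w} \<inter> {x. \<forall>n\<in>N. 0 < n \<bullet> x} \<in> lmeasurable"
    "measure lebesgue (convex hull {0, p, q, w} \<inter> {x. \<forall>n\<in>N. 0 < n \<bullet> x}) = \<bar>p \<bullet> (q \<times> w)\<bar> / 6"
    using measure_Int_open_halfspaces[OF assms(1,2)] measure_tetrahedron[of 0 p q w]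
    by (simp_all add: signed_volume_def)
qed

text \<open>Inside one chamber the prism contains three essentially disjoint tetrahedra with common
  vertex 0 and total volume \<open>h_star / 4\<close>; the 12 symmetries multiply this. The reverse
  inequality comes from the general upper bound.\<close>

lemma optimal_volume_le_measure: "3 * h_star \<le> measure lebesgue optimal_prism"
proof -
  define r h s where rhs: "r = r_star" "h = h_star" "s = sqrt 3"
  have r0: "r > 0" and h0: "h > 0" and s0: "s > 0" and ss: "s * s = 3" and rs: "r = s - 1"
    using r_star_pos h_star_pos r_star_eq(2) by (simp_all add: rhs)
  \<comment> \<open>\<open>C\<close> is the centre of the top triangle, \<open>M\<close> the
    midpoint of its edge from \<open>X\<close> to \<open>X3\<close>, and \<open>N\<close> the
    midpoint of the vertical edge from \<open>X\<close> to \<open>Y1\<close>. The triangles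
    \<open>C M X\<close>, \<open>A M X\<close> and \<open>A X N\<close> are the parts of three
    facets lying in the closed chamber.\<close>
  define A C M X N :: "real^3" where pts: "A = vector [1, 0, 0]" "C = vector [0, 0, h]"
    "M = vector [r / 2, 0, h]" "X = vector [r / 2, s * r / 2, h]" "N = vector [r / 2, s * r / 2, 0]"
  define A2 A3 X2 X3 Y1 :: "real^3" where pts': "A2 = vector [- 1/2, s / 2, 0]" "A3 = vector [- 1/2, - s / 2, 0]"
    "X2 = vector [- r, 0, h]" "X3 = vector [1/2 * r, - s / 2 * r, h]" "Y1 = vector [1/2 * r, s / 2 * r, - h]"
  have X_eq: "X = vector [1/2 * r, s / 2 * r, h]" unfolding pts by (simp add: vec_eq_iff forall_3 vector_3)
  have V: "{A, A2, A3, X, X2, X3, Y1} \<subseteq> optimal_vertices"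
    unfolding optimal_vertices_def X_eq rhs[symmetric] unfolding pts pts' by blast
  have K: "convex optimal_prism" and AK: "A \<in> optimal_prism" "A2 \<in> optimal_prism" "A3 \<in> optimal_prism"
    "X \<in> optimal_prism" "X2 \<in> optimal_prism" "X3 \<in> optimal_prism" "Y1 \<in> optimal_prism"
    unfolding optimal_prism_eq using V by (auto intro: hull_inc)
  have mid: "(1/2) *\<^sub>R p + (1/2) *\<^sub>R q \<in> optimal_prism" if "p \<in> optimal_prism" "q \<in> optimal_prism" for p q
    using convexD[OF K that, of "1/2" "1/2"] by simp
  have third: "(1/3) *\<^sub>R p + (2/3) *\<^sub>R q \<in> optimal_prism" if "p \<in> optimal_prism" "q \<in> optimal_prism" for p q
    using convexD[OF K that, of "1/3" "2/3"] by simp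
  have MK: "M \<in> optimal_prism"
  proof -
    have "M = (1/2) *\<^sub>R X + (1/2) *\<^sub>R X3" unfolding pts pts' by (simp add: vec_eq_iff forall_3 vector_3)
    then show ?thesis using mid AK by simp
  qed
  have NK: "N \<in> optimal_prism"
  proof -
    have "N = (1/2) *\<^sub>R X + (1/2) *\<^sub>R Y1" unfolding pts pts' by (simp add: vec_eq_iff forall_3 vector_3)
    then show ?thesis using mid AK by simp
  qed
  have CK: "C \<in> optimal_prism"
  proof -
    have "C = (1/3) *\<^sub>R X2 + (2/3) *\<^sub>R M" unfolding pts pts' by (simp add: vec_eq_iff forall_3 vector_3)
    then show ?thesis using third AK MK by simp
  qed
  have OK: "0 \<in> optimal_prism"
  proof -
    have "(1/3) *\<^sub>R A + (2/3) *\<^sub>R ((1/2) *\<^sub>R A2 + (1/2) *\<^sub>R A3) \<in> optimal_prism"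
      by (intro third mid AK)
    moreover have "(1/3) *\<^sub>R A + (2/3) *\<^sub>R ((1/2) *\<^sub>R A2 + (1/2) *\<^sub>R A3) = 0"
      unfolding pts pts' by (simp add: vec_eq_iff forall_3 vector_3)
    ultimately show ?thesis by (simp only:)
  qed
  have dot: "vector [p, q, w] \<bullet> x = p * x $ 1 + q * x $ 2 + w * x $ 3" for p q w and x :: "real^3"
    by (simp add: inner_vec_def sum_3 vector_3)
  have nonzero: "vector [p, q, w] = (0 :: real^3) \<longleftrightarrow> p = 0 \<and> q = 0 \<and> w = 0" for p q w
    by (simp add: vec_eq_iff forall_3 vector_3)
  \<comment> \<open>Inner normals of the chamber walls.\<close>
  define D :: "(real^3) set" where "D = {vector [0, 1, 0], vector [0, 0, 1], vector [s, - 1, 0]}"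
  \<comment> \<open>Opposite normals of two separating planes: \<open>n1\<close>, \<open>n2\<close>
    for the plane through 0, \<open>M\<close>, \<open>X\<close>, which parts \<open>T1\<close> from
    the others, and \<open>n3\<close>, \<open>n4\<close> for the plane through 0, \<open>A\<close>,
    \<open>X\<close>, which parts \<open>T2\<close> from \<open>T3\<close>.\<close>
  define n1 n2 n3 n4 :: "real^3" where n: "n1 = vector [- h, 0, r / 2]" "n2 = vector [h, 0, - r / 2]"
    "n3 = vector [0, - h, s * r / 2]" "n4 = vector [0, h, - (s * r / 2)]"
  define T1 where "T1 = convex hull {0, C, M, X} \<inter> {x. \<forall>n\<in>insert n1 D. 0 < n \<bullet> x}"
  define T2 where "T2 = convex hull {0, A, M, X} \<inter> {x. \<forall>n\<in>insert n2 (insert n3 D). 0 < n \<bullet> x}"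
  define T3 where "T3 = convex hull {0, A, X, N} \<inter> {x. \<forall>n\<in>insert n2 (insert n4 D). 0 < n \<bullet> x}"
  have T1: "T1 \<in> lmeasurable" "measure lebesgue T1 = \<bar>C \<bullet> (M \<times> X)\<bar> / 6"
  proof -
    have fin: "finite (insert n1 D)" by (simp add: D_def)
    have "m \<noteq> 0" if "m \<in> insert n1 D" for m
      using that r0 h0 s0 by (auto simp: D_def n nonzero)
    then have nz: "0 \<notin> insert n1 D" by blast
    have nn: "0 \<le> m \<bullet> x" if "m \<in> insert n1 D" "x \<in> {C, M, X}" for m x
      using that r0 h0 s0 by (auto simp: D_def n pts dot vector_3)
    show "T1 \<in> lmeasurable" "measure lebesgue T1 = \<bar>C \<bullet> (M \<times> X)\<bar> / 6"
      unfolding T1_def by (intro tetrahedron_Int_open_halfspaces fin nz nn; assumption)+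
  qed
  have T2: "T2 \<in> lmeasurable" "measure lebesgue T2 = \<bar>A \<bullet> (M \<times> X)\<bar> / 6"
  proof -
    have fin: "finite (insert n2 (insert n3 D))" by (simp add: D_def)
    have "m \<noteq> 0" if "m \<in> insert n2 (insert n3 D)" for m
      using that r0 h0 s0 by (auto simp: D_def n nonzero)
    then have nz: "0 \<notin> insert n2 (insert n3 D)" by blast
    have nn: "0 \<le> m \<bullet> x" if "m \<in> insert n2 (insert n3 D)" "x \<in> {A, M, X}" for m x
      using that r0 h0 s0 by (auto simp: D_def n pts dot vector_3)
    show "T2 \<in> lmeasurable" "measure lebesgue T2 = \<bar>A \<bullet> (M \<times> X)\<bar> / 6"
      unfolding T2_def by (intro tetrahedron_Int_open_halfspaces fin nz nn; assumption)+
  qed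
  have T3: "T3 \<in> lmeasurable" "measure lebesgue T3 = \<bar>A \<bullet> (X \<times> N)\<bar> / 6"
  proof -
    have fin: "finite (insert n2 (insert n4 D))" by (simp add: D_def)
    have "m \<noteq> 0" if "m \<in> insert n2 (insert n4 D)" for m
      using that r0 h0 s0 by (auto simp: D_def n nonzero)
    then have nz: "0 \<notin> insert n2 (insert n4 D)" by blast
    have nn: "0 \<le> m \<bullet> x" if "m \<in> insert n2 (insert n4 D)" "x \<in> {A, X, N}" for m x
      using that r0 h0 s0 by (auto simp: D_def n pts dot vector_3)
    show "T3 \<in> lmeasurable" "measure lebesgue T3 = \<bar>A \<bullet> (X \<times> N)\<bar> / 6"
      unfolding T3_def by (intro tetrahedron_Int_open_halfspaces fin nz nn; assumption)+
  qed
  have opp: "n1 \<bullet> x = - (n2 \<bullet> x)" "n3 \<bullet> x = - (n4 \<bullet> x)" for x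
    unfolding n dot by simp_all
  have disj: "T1 \<inter> T2 = {}" "T1 \<inter> T3 = {}" "T2 \<inter> T3 = {}"
    unfolding T1_def T2_def T3_def by (auto simp: opp)
  have "measure lebesgue (T1 \<union> T2 \<union> T3) = measure lebesgue T1 + measure lebesgue T2 + measure lebesgue T3"
    using disj by (intro measure_Un3_negligible T1 T2 T3) simp_all
  also have "\<dots> = (s * r * r / 4 + s * r) * h / 6"
  proof -
    have "C \<bullet> (M \<times> X) = h * (s * r * r / 4)" "A \<bullet> (M \<times> X) = - (h * (s * r / 2))" "A \<bullet> (X \<times> N) = - (h * (s * r / 2))"
      unfolding pts by (simp_all add: dot cross3_def vector_3)
    moreover have "h * (s * r * r / 4) > 0" "h * (s * r / 2) > 0" using r0 h0 s0 by simp_all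
    ultimately have "\<bar>C \<bullet> (M \<times> X)\<bar> = h * (s * r * r / 4)" "\<bar>A \<bullet> (M \<times> X)\<bar> = h * (s * r / 2)"
      "\<bar>A \<bullet> (X \<times> N)\<bar> = h * (s * r / 2)" by (simp_all only: abs_of_pos abs_minus_cancel)
    then show ?thesis unfolding T1 T2 T3 by (simp add: field_simps)
  qed
  also have "s * r * r / 4 + s * r = 3 / 2"
    unfolding rs using ss by (simp add: field_simps)
  finally have vol: "measure lebesgue (T1 \<union> T2 \<union> T3) = h / 4" by simp
  have "12 * measure lebesgue (T1 \<union> T2 \<union> T3) \<le> measure lebesgue optimal_prism"
  proof (rule measure_fundamental_chamber_le)
    show "T1 \<union> T2 \<union> T3 \<in> lmeasurable" using T1 T2 T3 by blast
    have "convex hull {0, C, M, X} \<subseteq> optimal_prism" "convex hull {0, A, M, X} \<subseteq> optimal_prism"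
      "convex hull {0, A, X, N} \<subseteq> optimal_prism"
      using OK CK MK NK AK by (simp_all add: hull_minimal K)
    then show "T1 \<union> T2 \<union> T3 \<subseteq> optimal_prism" unfolding T1_def T2_def T3_def by blast
    fix p assume "p \<in> T1 \<union> T2 \<union> T3"
    then have "\<forall>n\<in>D. 0 < n \<bullet> p" unfolding T1_def T2_def T3_def by blast
    then show "0 < p $ 2 \<and> 0 < p $ 3 \<and> p $ 2 < sqrt 3 * p $ 1"
      unfolding D_def rhs[symmetric] by (simp add: dot)
  qed
  then show ?thesis unfolding vol rhs by simp
qed

theorem theorem5p1:
  fixes P :: "(real^3) set"
  assumes "P \<in> TTP_class"
  shows "measure lebesgue P \<le> 3 * sqrt (2 * sqrt 3 - 3) \<and>
         (measure lebesgue P = 3 * sqrt (2 * sqrt 3 - 3) \<longleftrightarrow>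
           (\<exists>R :: real^3^3. rotation_matrix R \<and> P = (\<lambda>v. R *v v) ` optimal_prism))"
proof -
  have P: "polytope P" and sphere: "vertices P \<subseteq> sphere 0 1"
    using assms by (auto simp: TTP_class_def P9_def)
  have bound: "measure lebesgue P \<le> 3 * h_star \<and> (measure lebesgue P = 3 * h_star \<longrightarrow>
      (\<exists>R :: real^3^3. rotation_matrix R \<and> P = (\<lambda>v. R *v v) ` optimal_prism))"
  proof (cases "interior P = {}")
    case True
    \<comment> \<open>The cone argument starts from an interior point; without one the volume is 0
      and lies strictly below the bound.\<close>
    then have "negligible P" using negligible_convex_interior[OF polytope_imp_convex[OF P]] by simp
    then have "measure lebesgue P = 0" by (rule negligible_imp_measure0)
    then show ?thesis using h_star_pos by simp
  next
    case False
    then obtain p where p: "p \<in> interior P" by blast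
    obtain x1 x2 x3 y1 y2 y3 a1 a2 a3 where lab:
      "distinct [x1, x2, x3, y1, y2, y3, a1, a2, a3]"
      "vertices P = {x1, x2, x3, y1, y2, y3, a1, a2, a3}"
      "{F. F facet_of P} = (hull) convex ` prism_triangles x1 x2 x3 y1 y2 y3 a1 a2 a3"
      "0 < signed_volume p x1 x2 x3"
      by (rule TTP_class_oriented_labelling[OF assms p])
    have le: "6 * measure lebesgue P \<le> ttp_functional x1 x2 x3 y1 y2 y3 a1 a2 a3"
      by (rule measure_le_ttp_functional[OF P p lab])
    have norms: "norm x1 = 1" "norm x2 = 1" "norm x3 = 1" "norm y1 = 1" "norm y2 = 1" "norm y3 = 1"
      "norm a1 = 1" "norm a2 = 1" "norm a3 = 1"
      using sphere unfolding lab(2) by simp_all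
    have le': "ttp_functional x1 x2 x3 y1 y2 y3 a1 a2 a3 \<le> 18 * h_star"
      by (rule ttp_functional_bound(1)[OF norms])
    have "\<exists>R :: real^3^3. rotation_matrix R \<and> P = (\<lambda>v. R *v v) ` optimal_prism"
      if "measure lebesgue P = 3 * h_star"
    proof -
      have "ttp_functional x1 x2 x3 y1 y2 y3 a1 a2 a3 = 18 * h_star" using le le' that by simp
      then obtain R :: "real^3^3" where R: "rotation_matrix R" "vertices P = (\<lambda>v. R *v v) ` optimal_vertices"
        using ttp_functional_bound(2)[OF norms] unfolding lab(2) by blast
      have "P = convex hull (vertices P)"
        using face_of_polytope_hull_vertices[OF P face_of_refl] polytope_imp_convex[OF P] by blast
      also have "\<dots> = (\<lambda>v. R *v v) ` optimal_prism"
        unfolding R(2) optimal_prism_eq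
        by (rule convex_hull_linear_image[symmetric]) (rule matrix_vector_mul_linear)
      finally show ?thesis using R(1) by blast
    qed
    then show ?thesis using le le' by simp
  qed
  \<comment> \<open>The lower bound for the optimal prism passes to its rotation \<open>P\<close>
    and meets \<open>bound\<close>, which applies since \<open>P\<close> belongs to the
    class.\<close>
  moreover have "measure lebesgue P = 3 * h_star"
    if "rotation_matrix R" "P = (\<lambda>v. R *v v) ` optimal_prism" for R :: "real^3^3"
  proof -
    have "orthogonal_transformation (\<lambda>v. R *v v)"
      using that(1) by (simp add: rotation_matrix_def orthogonal_transformation_matrix)
    then have "measure lebesgue P = measure lebesgue optimal_prism"
      unfolding that(2) by (rule measure_orthogonal_image[OF _ optimal_prism_lmeasurable])
    then show ?thesis using bound optimal_volume_le_measure by linarith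
  qed
  ultimately show ?thesis unfolding h_star_def[symmetric] by blast
qed

end
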